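(* Let $n\ge 4$ and let $p$ be an integer with $(n-1)(n-3)\le p\le \frac{n!-2}{2}$. Then there exists a symmetric set $S\subseteq S_n$ with $|S|=p$ such that $\iota_n\notin S$ and $\delta_n\notin S$.
   Context: $S_n$ is the symmetric group on $[n]=\{1,\dots,n\}$; permutations are written in one-line notation. For $w\in S_n$, $\mathrm{Des}(w)=\{i\in[n-1] : w(i)>w(i+1)\}$. For $D\subseteq[n-1]$, Gessel's fundamental quasisymmetric function is $F_{n,D}=\sum x_{i_1}x_{i_2}\cdots x_{i_n}$, the sum over all $i_1\le i_2\le\cdots\le i_n$ (positive integers) with $i_j<i_{j+1}$ whenever $j\in D$. For $S\subseteq S_n$, $Q(S)=\sum_{w\in S}F_{n,\mathrm{Des}(w)}$. The set $S$ is called symmetric if $Q(S)$ is a symmetric function. The monotone elements are $\iota_n=12\cdots n$ and $\delta_n=n(n-1)\cdots 1$. *)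

theory Defs
  imports "HOL-Combinatorics.Permutations"
begin

text \<open>Permutations of [n] = {1..n} are functions w with w permutes {1..n}.\<close>

definition Des :: "nat \<Rightarrow> (nat \<Rightarrow> nat) \<Rightarrow> nat set" where
  "Des n w = {i \<in> {1..n-1}. w i > w (Suc i)}"

text \<open>Coefficient of the monomial prod_k x_k^(a k) in Gessel's fundamental quasisymmetric
  function F_{n,D}. Variables x_1, x_2, ... are indexed by positive integers; the sequence
  i_1 <= ... <= i_n is stored 0-based as i 0, ..., i (n-1); position j+1 (1-based) is in D
  iff i_{j+1} < i_{j+2} is required.\<close>
definition Fcoeff :: "nat \<Rightarrow> nat set \<Rightarrow> (nat \<Rightarrow> nat) \<Rightarrow> nat" where
  "Fcoeff n D a = card {i :: nat \<Rightarrow> nat.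
      (\<forall>j<n. 1 \<le> i j) \<and> (\<forall>j\<ge>n. i j = 0) \<and>
      (\<forall>j. Suc j < n \<longrightarrow> i j \<le> i (Suc j)) \<and>
      (\<forall>j. Suc j < n \<longrightarrow> Suc j \<in> D \<longrightarrow> i j < i (Suc j)) \<and>
      (\<forall>k. a k = card {j. j < n \<and> i j = k})}"

definition Qcoeff :: "nat \<Rightarrow> (nat \<Rightarrow> nat) set \<Rightarrow> (nat \<Rightarrow> nat) \<Rightarrow> nat" where
  "Qcoeff n S a = (\<Sum>w\<in>S. Fcoeff n (Des n w) a)"

definition symmetric_set :: "nat \<Rightarrow> (nat \<Rightarrow> nat) set \<Rightarrow> bool" where
  "symmetric_set n S \<longleftrightarrow>
     (\<forall>\<sigma> a. \<sigma> permutes {1..} \<longrightarrow> Qcoeff n S (a \<circ> \<sigma>) = Qcoeff n S a)"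

definition iota :: "nat \<Rightarrow> (nat \<Rightarrow> nat)" where
  "iota n = id"

definition delta :: "nat \<Rightarrow> (nat \<Rightarrow> nat)" where
  "delta n = (\<lambda>i. if 1 \<le> i \<and> i \<le> n then n + 1 - i else i)"

end

theory Submission
  imports Defs
begin

text \<open>
  The coefficient of a monomial in \<open>F\<^bsub>n,D\<^esub>\<close> is 1 or 0 according to whether \<open>D\<close> is contained in the set
  of partial sums of the exponents. Symmetry of a set of permutations therefore only depends on the
  number \<open>c D\<close> of its elements with descent set \<open>D\<close>, and any \<open>c\<close> bounded by the number \<open>beta n D\<close> of all
  permutations with descent set \<open>D\<close> is realised by a set. Small sizes come from the functions of
  shapes \<open>(n-1,1)\<close>, \<open>(n-2,1,1)\<close>, \<open>(2,1,...,1)\<close> (of sizes \<open>n-1\<close>, \<open>(n-1)(n-2)/2\<close>, \<open>n-1\<close>) and one further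
  symmetric function of size \<open>n\<close>: the semigroup generated by \<open>n-1\<close> and \<open>n\<close> contains all
  numbers from \<open>(n-1)(n-3)\<close> on except \<open>(n-1)(n-2)-1\<close>.

  For large sizes one inserts the letter \<open>n\<close> in all positions into the elements of a symmetric set in
  \<open>S\<^bsub>n-1\<^esub>\<close>, which multiplies its function by \<open>h\<^sub>1\<close> and its size by \<open>n\<close>. The residue modulo \<open>n\<close> is
  then corrected by adding or removing copies of shape \<open>(n-1,1)\<close>, of size \<open>n - 1\<close>. The upper bound
  \<open>(n! - 2)/2\<close> reproduces itself under this step.
\<close>

section \<open>Fundamental quasisymmetric functions and partial sums\<close>

definition psum :: "(nat \<Rightarrow> nat) \<Rightarrow> nat \<Rightarrow> nat" where
  "psum a m = (\<Sum>k\<le>m. a k)"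

text \<open>For exponents of degree \<open>n\<close> these are the block ends below \<open>n\<close>
  of the sorted word, that is, the places where it increases strictly.\<close>

definition cuts :: "nat \<Rightarrow> (nat \<Rightarrow> nat) \<Rightarrow> nat set" where
  "cuts n a = {1..n-1} \<inter> range (psum a)"

definition weight :: "nat \<Rightarrow> (nat \<Rightarrow> nat) \<Rightarrow> bool" where
  "weight n a \<longleftrightarrow> a 0 = 0 \<and> finite {k. a k \<noteq> 0} \<and> sum a {k. a k \<noteq> 0} = n"

text \<open>The sorted word with exponents \<open>a\<close>: position \<open>j\<close>, counted from
  0, carries the first letter whose partial sum exceeds \<open>j\<close>. The value 0 from
  \<open>n\<close> on matches the convention in \<open>Fcoeff\<close>.\<close>

definition word_of :: "nat \<Rightarrow> (nat \<Rightarrow> nat) \<Rightarrow> (nat \<Rightarrow> nat)" where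
  "word_of n a = (\<lambda>j. if j < n then (LEAST m. j < psum a m) else 0)"

lemma psum_mono: "m \<le> m' \<Longrightarrow> psum a m \<le> psum a m'"
  unfolding psum_def by (intro sum_mono2) auto

lemma psum_Suc: "psum a (Suc m) = psum a m + a (Suc m)"
  by (simp add: psum_def)

lemma weight_psum_le: "weight n a \<Longrightarrow> psum a m \<le> n"
proof -
  assume w: "weight n a"
  have "psum a m = sum a ({..m} \<inter> {k. a k \<noteq> 0})"
    unfolding psum_def by (rule sum.mono_neutral_right) auto
  also have "\<dots> \<le> sum a {k. a k \<noteq> 0}"
    using w by (intro sum_mono2) (auto simp: weight_def)
  finally show ?thesis using w by (simp add: weight_def)
qed

lemma weight_psum_eq: "weight n a \<Longrightarrow> \<exists>m. psum a m = n"
proof -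
  assume w: "weight n a"
  then obtain m where m: "{k. a k \<noteq> 0} \<subseteq> {..m}"
    by (auto simp: weight_def finite_nat_set_iff_bounded_le)
  have "psum a m = sum a {k. a k \<noteq> 0}"
    unfolding psum_def using m by (intro sum.mono_neutral_right) auto
  then show ?thesis using w by (auto simp: weight_def)
qed

text \<open>The equivalence determines the word; \<open>sorted_content_le_iff\<close> gives the same
  one for an arbitrary sorted word, which yields uniqueness.\<close>

lemma word_of_le_iff:
  assumes "weight n a" "j < n"
  shows "word_of n a j \<le> m \<longleftrightarrow> j < psum a m"
proof
  obtain M where "psum a M = n" using weight_psum_eq[OF assms(1)] by blast
  then have L: "j < psum a (LEAST m. j < psum a m)"
    using assms(2) by (metis (mono_tags, lifting) LeastI)
  assume "word_of n a j \<le> m"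
  then have "(LEAST m. j < psum a m) \<le> m" using assms(2) by (simp add: word_of_def)
  then show "j < psum a m" using L psum_mono by (meson order_less_le_trans)
next
  assume "j < psum a m"
  then show "word_of n a j \<le> m" using assms(2) by (simp add: word_of_def Least_le)
qed

lemma card_word_of:
  assumes "weight n a"
  shows "card {j. j < n \<and> word_of n a j = k} = a k"
proof -
  have S: "{j. j < n \<and> word_of n a j \<le> m} = {..<psum a m}" for m
    using word_of_le_iff[OF assms] weight_psum_le[OF assms, of m] by auto
  show ?thesis
  proof (cases k)
    case 0
    have "{j. j < n \<and> word_of n a j = 0} = {..<psum a 0}" using S[of 0] by simp
    then show ?thesis using 0 by (simp add: psum_def)
  next
    case (Suc l)
    have "{j. j < n \<and> word_of n a j = k} =
      {j. j < n \<and> word_of n a j \<le> k} - {j. j < n \<and> word_of n a j \<le> l}"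
      using Suc by auto
    also have "\<dots> = {psum a l..<psum a k}" unfolding S by auto
    finally show ?thesis by (simp add: Suc psum_Suc)
  qed
qed

lemma content_weight:
  fixes i :: "nat \<Rightarrow> nat"
  assumes "\<forall>j<n. 1 \<le> i j" "\<forall>k. a k = card {j. j < n \<and> i j = k}"
  shows "weight n a"
proof -
  have sup: "{k. a k \<noteq> 0} = i ` {..<n}" using assms(2) by auto
  have "sum a (i ` {..<n}) = (\<Sum>k\<in>i ` {..<n}. card {j \<in> {..<n}. i j = k})"
    using assms(2) by simp
  also have "\<dots> = (\<Sum>k\<in>i ` {..<n}. \<Sum>j\<in>{j \<in> {..<n}. i j = k}. 1)" by simp
  also have "\<dots> = (\<Sum>j<n. 1)" by (rule sum.image_gen[symmetric]) simp
  finally show ?thesis using assms unfolding weight_def sup by auto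
qed

text \<open>In a sorted word the letters at most \<open>m\<close> form an initial segment, and its
  length is \<open>psum a m\<close>.\<close>

lemma sorted_content_le_iff:
  fixes i :: "nat \<Rightarrow> nat"
  assumes mon: "\<forall>j. Suc j < n \<longrightarrow> i j \<le> i (Suc j)"
    and a: "\<forall>k. a k = card {j. j < n \<and> i j = k}" and "j < n"
  shows "i j \<le> m \<longleftrightarrow> j < psum a m"
proof -
  have mono: "i j \<le> i j'" if "j \<le> j'" "j' < n" for j j'
    using that by (induction j' rule: dec_induct) (use mon in \<open>auto intro: order_trans\<close>)
  define T where "T = {j. j < n \<and> i j \<le> m}"
  have T: "T = (\<Union>k\<le>m. {j. j < n \<and> i j = k})" by (auto simp: T_def)
  have "card T = (\<Sum>k\<le>m. card {j. j < n \<and> i j = k})"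
    unfolding T by (rule card_UN_disjoint) auto
  then have c: "card T = psum a m" using a by (simp add: psum_def)
  have fin: "finite T" by (simp add: T_def)
  show ?thesis
  proof
    assume "i j \<le> m"
    then have "{..j} \<subseteq> T" using mono \<open>j < n\<close> by (fastforce simp: T_def)
    then have "card {..j} \<le> card T" using fin card_mono by blast
    then show "j < psum a m" using c by simp
  next
    assume l: "j < psum a m"
    show "i j \<le> m"
    proof (rule ccontr)
      assume n: "\<not> i j \<le> m"
      have "T \<subseteq> {..<j}"
      proof
        fix t assume "t \<in> T"
        then show "t \<in> {..<j}" using n mono[of j t] by (force simp: T_def)
      qed
      then have "card T \<le> j" using card_mono[of "{..<j}" T] by simp
      then show False using c l by simp
    qed
  qed
qed

text \<open>Only \<open>word_of n a\<close> can have the exponents \<open>a\<close>, and it counts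
  iff every required strict increase falls on a block end.\<close>

lemma Fcoeff_eq:
  assumes D: "D \<subseteq> {1..n-1}"
  shows "Fcoeff n D a = (if weight n a \<and> D \<subseteq> cuts n a then 1 else 0)"
proof -
  let ?X = "{i :: nat \<Rightarrow> nat.
      (\<forall>j<n. 1 \<le> i j) \<and> (\<forall>j\<ge>n. i j = 0) \<and>
      (\<forall>j. Suc j < n \<longrightarrow> i j \<le> i (Suc j)) \<and>
      (\<forall>j. Suc j < n \<longrightarrow> Suc j \<in> D \<longrightarrow> i j < i (Suc j)) \<and>
      (\<forall>k. a k = card {j. j < n \<and> i j = k})}"
  have cut: "i j < i (Suc j) \<longleftrightarrow> Suc j \<in> cuts n a"
    if "Suc j < n" and E: "\<And>j m. j < n \<Longrightarrow> i j \<le> m \<longleftrightarrow> j < psum a m" for i :: "nat \<Rightarrow> nat" and j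
  proof -
    \<comment> \<open>A letter \<open>m\<close> separates positions \<open>j\<close> and
      \<open>j + 1\<close> exactly when the letters up to \<open>m\<close> fill the first
      \<open>j + 1\<close> places.\<close>
    have e: "i j \<le> m \<and> \<not> i (Suc j) \<le> m \<longleftrightarrow> psum a m = Suc j" for m
      using E[of j m] E[of "Suc j" m] that(1) by linarith
    have "i j < i (Suc j) \<longleftrightarrow> (\<exists>m. i j \<le> m \<and> \<not> i (Suc j) \<le> m)"
      by (meson leI le_less_trans less_le_not_le order_refl)
    also have "\<dots> \<longleftrightarrow> (\<exists>m. psum a m = Suc j)" unfolding e ..
    also have "\<dots> \<longleftrightarrow> Suc j \<in> cuts n a"
    proof -
      have "Suc j \<in> {1..n-1}" using that(1) by simp
      then have "Suc j \<in> cuts n a \<longleftrightarrow> Suc j \<in> range (psum a)" unfolding cuts_def by blast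
      also have "\<dots> \<longleftrightarrow> (\<exists>m. psum a m = Suc j)" unfolding image_iff by (simp add: eq_commute)
      finally show ?thesis by (rule sym)
    qed
    finally show ?thesis .
  qed
  have sub: "?X \<subseteq> {word_of n a}"
  proof
    fix i assume "i \<in> ?X"
    then have i: "\<forall>j<n. 1 \<le> i j" "\<forall>j\<ge>n. i j = 0" "\<forall>j. Suc j < n \<longrightarrow> i j \<le> i (Suc j)"
      "\<forall>k. a k = card {j. j < n \<and> i j = k}" by blast+
    have w: "weight n a" using content_weight[OF i(1,4)] .
    have "i j = word_of n a j" for j
    proof (cases "j < n")
      case True
      then have "\<forall>m. i j \<le> m \<longleftrightarrow> word_of n a j \<le> m"
        using sorted_content_le_iff[OF i(3,4)] word_of_le_iff[OF w] by simp
      then show ?thesis by (meson le_antisym order_refl)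
    next
      case False
      then show ?thesis using i(2) by (simp add: word_of_def)
    qed
    then show "i \<in> {word_of n a}" by auto
  qed
  have mem: "word_of n a \<in> ?X \<longleftrightarrow> weight n a \<and> D \<subseteq> cuts n a"
  proof
    assume X: "word_of n a \<in> ?X"
    then have "\<forall>j<n. 1 \<le> word_of n a j" "\<forall>k. a k = card {j. j < n \<and> word_of n a j = k}"
      by blast+
    then have w: "weight n a" by (rule content_weight)
    have "d \<in> cuts n a" if "d \<in> D" for d
    proof -
      obtain j where j: "d = Suc j" "Suc j < n" using D \<open>d \<in> D\<close> by (cases d) auto
      have "word_of n a j < word_of n a (Suc j)" using X j that by blast
      then show ?thesis using cut[OF j(2) word_of_le_iff[OF w]] j by blast
    qed
    with w show "weight n a \<and> D \<subseteq> cuts n a" by auto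
  next
    assume w: "weight n a \<and> D \<subseteq> cuts n a"
    then have le: "\<And>j m. j < n \<Longrightarrow> word_of n a j \<le> m \<longleftrightarrow> j < psum a m"
      using word_of_le_iff by blast
    have "1 \<le> word_of n a j" if "j < n" for j
      using le[OF that, of 0] w by (simp add: psum_def weight_def)
    moreover have "word_of n a j \<le> word_of n a (Suc j)" if "Suc j < n" for j
    proof -
      have "Suc j < psum a (word_of n a (Suc j))"
        using le[of "Suc j" "word_of n a (Suc j)"] that by simp
      then show ?thesis using le[of j "word_of n a (Suc j)"] that by simp
    qed
    moreover have "word_of n a j < word_of n a (Suc j)" if "Suc j < n" "Suc j \<in> D" for j
      using cut[OF that(1) le] that w by blast
    moreover have "\<forall>j\<ge>n. word_of n a j = 0" by (simp add: word_of_def)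
    moreover have "\<forall>k. a k = card {j. j < n \<and> word_of n a j = k}"
      using card_word_of[of n a] w by simp
    ultimately show "word_of n a \<in> ?X" by blast
  qed
  define X where "X = ?X"
  have F: "Fcoeff n D a = card X" unfolding X_def by (rule Fcoeff_def)
  note X = sub[folded X_def] mem[folded X_def]
  show ?thesis
  proof (cases "weight n a \<and> D \<subseteq> cuts n a")
    case True
    then have "X = {word_of n a}" using X by blast
    then show ?thesis unfolding F if_P[OF True] by simp
  next
    case False
    then have "X = {}" using X by blast
    then show ?thesis unfolding F if_not_P[OF False] by simp
  qed
qed

lemma weight_comp:
  assumes "\<sigma> permutes {1..}" "weight n a"
  shows "weight n (a \<circ> \<sigma>)"
proof -
  have e: "{k. (a \<circ> \<sigma>) k \<noteq> 0} = inv \<sigma> ` {k. a k \<noteq> 0}"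
    using permutes_inverses[OF assms(1)] by (force simp: image_iff)
  have "inj_on (inv \<sigma>) X" for X
    using permutes_inj[OF permutes_inv[OF assms(1)]] by (metis inj_on_subset subset_UNIV)
  then have "sum (a \<circ> \<sigma>) {k. (a \<circ> \<sigma>) k \<noteq> 0} = sum a {k. a k \<noteq> 0}"
    unfolding e using permutes_inverses[OF assms(1)] by (simp add: sum.reindex)
  moreover have "\<sigma> 0 = 0" using assms(1) by (auto intro: permutes_not_in)
  ultimately show ?thesis using assms(2) unfolding weight_def e by auto
qed

lemma weight_comp_iff: "\<sigma> permutes {1..} \<Longrightarrow> weight n (a \<circ> \<sigma>) \<longleftrightarrow> weight n a"
  using weight_comp[of \<sigma> n a] weight_comp[OF permutes_inv, of \<sigma> n "a \<circ> \<sigma>"]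
  by (auto simp: o_assoc[symmetric] permutes_inv_o)

section \<open>Symmetric coefficient functions\<close>

text \<open>By \<open>Fcoeff_eq\<close> the sum over subsets of \<open>cuts n a\<close> is the
  coefficient at \<open>a\<close> of the combination of fundamental functions given by
  \<open>c\<close>. Integer values allow differences.\<close>

definition symmetric_coeffs :: "nat \<Rightarrow> (nat set \<Rightarrow> int) \<Rightarrow> bool" where
  "symmetric_coeffs n c \<longleftrightarrow> (\<forall>\<sigma> a. \<sigma> permutes {1..} \<longrightarrow> weight n a \<longrightarrow>
     sum c (Pow (cuts n (a \<circ> \<sigma>))) = sum c (Pow (cuts n a)))"

lemma symmetric_coeffs_add:
  "symmetric_coeffs n c \<Longrightarrow> symmetric_coeffs n d \<Longrightarrow> symmetric_coeffs n (\<lambda>D. c D + d D)"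
  by (simp add: symmetric_coeffs_def sum.distrib)

lemma symmetric_coeffs_diff:
  "symmetric_coeffs n c \<Longrightarrow> symmetric_coeffs n d \<Longrightarrow> symmetric_coeffs n (\<lambda>D. c D - d D)"
  by (simp add: symmetric_coeffs_def sum_subtractf)

lemma symmetric_coeffs_scale:
  "symmetric_coeffs n c \<Longrightarrow> symmetric_coeffs n (\<lambda>D. k * c D)"
  by (simp add: symmetric_coeffs_def sum_distrib_left[symmetric])

lemma finite_cuts [simp]: "finite (cuts n a)"
  by (simp add: cuts_def)

section \<open>Block ends and adjacent non-cuts\<close>

text \<open>Each occurring letter closes one block, and the block ends are the cuts together with
  \<open>n\<close>. Hence the number of cuts depends only on the size of the support.\<close>

lemma bij_betw_psum:
  assumes w: "weight n a" and n: "n \<ge> 1"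
  shows "bij_betw (psum a) {k. a k \<noteq> 0} (insert n (cuts n a))"
proof -
  have lt: "psum a k < psum a k'" if "k < k'" "a k' \<noteq> 0" for k k'
  proof -
    obtain l where l: "k' = Suc l" using \<open>k < k'\<close> by (cases k') auto
    then have "psum a k \<le> psum a l" using that by (intro psum_mono) auto
    then show ?thesis using that l by (simp add: psum_Suc)
  qed
  have "inj_on (psum a) {k. a k \<noteq> 0}"
  proof (rule inj_onI)
    fix x y assume "x \<in> {k. a k \<noteq> 0}" "y \<in> {k. a k \<noteq> 0}" "psum a x = psum a y"
    then show "x = y" using lt[of x y] lt[of y x] by (cases x y rule: linorder_cases) auto
  qed
  moreover have "psum a k \<in> insert n (cuts n a)" if "a k \<noteq> 0" for k
  proof -
    have "a k \<le> psum a k" unfolding psum_def by (rule member_le_sum) auto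
    then show ?thesis using that weight_psum_le[OF w, of k] by (auto simp: cuts_def)
  qed
  moreover have "d \<in> psum a ` {k. a k \<noteq> 0}" if "d \<in> insert n (cuts n a)" for d
  proof -
    have ex: "\<exists>m. psum a m = d" using that weight_psum_eq[OF w] by (auto simp: cuts_def)
    \<comment> \<open>The least index reaching \<open>d\<close> has a nonzero exponent; otherwise an
      earlier index would reach \<open>d\<close>, or \<open>d\<close> would be 0.\<close>
    define m where "m = (LEAST m. psum a m = d)"
    have m: "psum a m = d" unfolding m_def using ex by (rule LeastI_ex)
    have "d \<ge> 1" using that n by (auto simp: cuts_def)
    have "a m \<noteq> 0"
    proof
      assume z: "a m = 0"
      show False
      proof (cases m)
        case 0
        then show False using m z \<open>d \<ge> 1\<close> by (simp add: psum_def)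
      next
        case (Suc l)
        then have "psum a l = d" using m z by (simp add: psum_Suc)
        then have "m \<le> l" unfolding m_def by (rule Least_le)
        then show False using Suc by simp
      qed
    qed
    then show ?thesis using m by auto
  qed
  ultimately show ?thesis unfolding bij_betw_def by blast
qed

lemma card_cuts:
  assumes "weight n a" "n \<ge> 1"
  shows "Suc (card (cuts n a)) = card {k. a k \<noteq> 0}"
proof -
  have "n \<notin> cuts n a" using assms(2) by (auto simp: cuts_def)
  then show ?thesis using bij_betw_same_card[OF bij_betw_psum[OF assms]] by simp
qed

text \<open>A block of length \<open>r\<close> hides \<open>r - 1\<close> consecutive non-cuts. The
  right side is visibly invariant under permuting the exponents.\<close>

lemma adjacent_non_cuts_iff:
  assumes w: "weight n a"
  shows "(\<exists>d. d \<in> {1..n-1} - cuts n a \<and> Suc d \<in> {1..n-1} - cuts n a) \<longleftrightarrow> (\<exists>k. 3 \<le> a k)"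
proof
  assume "\<exists>d. d \<in> {1..n-1} - cuts n a \<and> Suc d \<in> {1..n-1} - cuts n a"
  then obtain d where d: "1 \<le> d" "Suc d \<le> n-1" "d \<notin> cuts n a" "Suc d \<notin> cuts n a" by auto
  have no: "psum a m \<noteq> d \<and> psum a m \<noteq> Suc d" for m
  proof -
    have "d \<notin> range (psum a)" "Suc d \<notin> range (psum a)" using d by (auto simp: cuts_def)
    then show ?thesis by (metis rangeI)
  qed
  \<comment> \<open>The block of \<open>k\<close> contains place \<open>d\<close>; as it ends
    neither at \<open>d\<close> nor at \<open>d + 1\<close>, it also contains \<open>d + 1\<close>
    and \<open>d + 2\<close>.\<close>
  define k where "k = (LEAST m. d \<le> psum a m)"
  obtain M where "psum a M = n" using weight_psum_eq[OF w] by blast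
  then have "\<exists>m. d \<le> psum a m" using d by (intro exI[of _ M]) simp
  then have k: "d \<le> psum a k" unfolding k_def by (rule LeastI_ex)
  obtain l where l: "k = Suc l"
    using k d(1) w by (cases k) (auto simp: psum_def weight_def)
  have "\<not> d \<le> psum a l"
    using not_less_Least[of l "\<lambda>m. d \<le> psum a m"] l unfolding k_def by simp
  then have "3 \<le> a k" using no[of k] k l by (simp add: psum_Suc)
  then show "\<exists>k. 3 \<le> a k" ..
next
  assume "\<exists>k. 3 \<le> a k"
  then obtain k where k: "3 \<le> a k" ..
  obtain l where l: "k = Suc l" using w k by (cases k) (auto simp: weight_def)
  define d where "d = Suc (psum a l)"
  have no: "psum a m \<noteq> d \<and> psum a m \<noteq> Suc d" for m
    using psum_mono[of m l a] psum_mono[of k m a] k l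
    by (cases "m \<le> l") (auto simp: d_def psum_Suc)
  have "Suc d \<le> n - 1" using weight_psum_le[OF w, of k] k l by (simp add: d_def psum_Suc)
  then show "\<exists>d. d \<in> {1..n-1} - cuts n a \<and> Suc d \<in> {1..n-1} - cuts n a"
  proof -
    have "d \<notin> cuts n a" "Suc d \<notin> cuts n a" unfolding cuts_def using no by (metis IntD2 imageE)+
    then show ?thesis using \<open>Suc d \<le> n - 1\<close> by (intro exI[of _ d]) (auto simp: d_def)
  qed
qed

lemma card_comp_permutes:
  assumes "\<sigma> permutes {1..}"
  shows "card {k. (a \<circ> \<sigma>) k \<noteq> (0::nat)} = card {k. a k \<noteq> 0}"
proof -
  have "{k. (a \<circ> \<sigma>) k \<noteq> 0} = \<sigma> -` {k. a k \<noteq> 0}" by auto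
  then show ?thesis
    using card_vimage_inj[of \<sigma> "{k. a k \<noteq> 0}"] permutes_inj[OF assms] permutes_surj[OF assms]
    by simp
qed

section \<open>Two families of symmetric coefficient functions\<close>

text \<open>The coefficients of a hook Schur function depend on the number of descents only.\<close>

lemma symmetric_coeffs_card:
  assumes "n \<ge> 1"
  shows "symmetric_coeffs n (\<lambda>D. f (card D))"
proof -
  have "sum (\<lambda>D. f (card D)) (Pow P) = (\<Sum>k\<le>card P. of_nat (card P choose k) * f k)"
    if fin: "finite P" for P :: "nat set" and f :: "nat \<Rightarrow> int"
  proof -
    have "sum (\<lambda>D. f (card D)) (Pow P) =
        (\<Sum>k\<le>card P. sum (\<lambda>D. f (card D)) {D \<in> Pow P. card D = k})"
      using fin by (intro sum.group[symmetric]) (auto intro: card_mono)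
    also have "\<dots> = (\<Sum>k\<le>card P. of_nat (card P choose k) * f k)"
    proof (rule sum.cong[OF refl])
      fix k
      have "sum (\<lambda>D. f (card D)) {D \<in> Pow P. card D = k} = sum (\<lambda>D. f k) {D. D \<subseteq> P \<and> card D = k}"
        by (intro sum.cong) auto
      then show "sum (\<lambda>D. f (card D)) {D \<in> Pow P. card D = k} = of_nat (card P choose k) * f k"
        using n_subsets[OF fin, of k] by simp
    qed
    finally show ?thesis .
  qed
  moreover have "card (cuts n (a \<circ> \<sigma>)) = card (cuts n a)"
    if "\<sigma> permutes {1..}" "weight n a" for \<sigma> a
    using card_cuts[OF that(2) assms] card_cuts[OF weight_comp[OF that] assms]
      card_comp_permutes[OF that(1), of a] by simp
  ultimately show ?thesis unfolding symmetric_coeffs_def by simp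
qed

text \<open>Its nonzero values are the coefficients of the image of \<open>h\<^bsub>n-1\<^esub> h\<^sub>1 - h\<^bsub>n-2\<^esub> p\<^sub>2\<close> under the
  involution \<open>\<omega>\<close>; note that \<open>i = 0\<close> and \<open>i = n - 1\<close> remove a single element only.\<close>

definition near_top :: "nat \<Rightarrow> nat set \<Rightarrow> int" where
  "near_top n D = int (card {i. i < n \<and> {1..n-1} - {i, Suc i} = D})"

lemma sum_near_top:
  assumes "finite P"
  shows "sum (near_top n) (Pow P) = int (card {i. i < n \<and> {1..n-1} - {i, Suc i} \<subseteq> P})"
proof -
  let ?I = "{i. i < n \<and> {1..n-1} - {i, Suc i} \<subseteq> P}"
  have "card ?I = (\<Sum>i\<in>?I. 1)" by simp
  also have "\<dots> = (\<Sum>D\<in>Pow P. \<Sum>i\<in>{i \<in> ?I. {1..n-1} - {i, Suc i} = D}. 1)"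
    using assms by (intro sum.group[symmetric]) auto
  also have "\<dots> = (\<Sum>D\<in>Pow P. card {i. i < n \<and> {1..n-1} - {i, Suc i} = D})"
    by (intro sum.cong refl) (auto intro!: arg_cong[where f=card])
  finally show ?thesis by (simp add: near_top_def)
qed

text \<open>To be used for the set \<open>C\<close> of non-cuts: only its size and the existence of
  adjacent elements matter. A single \<open>d\<close> is covered by \<open>i = d - 1\<close> and
  \<open>i = d\<close>, also at the ends because \<open>i\<close> runs from 0 to
  \<open>n - 1\<close>.\<close>

lemma card_adjacent_cover:
  assumes C: "C \<subseteq> {1..n-1}"
  shows "card {i. i < n \<and> C \<subseteq> {i, Suc i}} =
    (if card C = 0 then n else if card C = 1 then 2
     else if card C = 2 \<and> (\<exists>d. d \<in> C \<and> Suc d \<in> C) then 1 else 0)"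
proof -
  have fin: "finite C" using C finite_subset by blast
  consider "card C = 0" | "card C = 1" | "card C = 2" | "card C > 2" by linarith
  then show ?thesis
  proof cases
    case 1
    then have "C = {}" using fin by simp
    then show ?thesis by simp
  next
    case 2
    then obtain d where d: "C = {d}" using card_1_singletonE by metis
    then have "{i. i < n \<and> C \<subseteq> {i, Suc i}} = {d - 1, d}" "d \<ge> 1" using C by auto
    then show ?thesis using d by simp
  next
    case 3
    then obtain x y where "C = {x, y}" "x \<noteq> y" by (meson card_2_iff)
    then obtain x y where xy: "C = {x, y}" "x < y" by (metis insert_commute linorder_neqE_nat)
    then have "{i. i < n \<and> C \<subseteq> {i, Suc i}} = (if y = Suc x then {x} else {})" using C by auto
    moreover have "(\<exists>d. d \<in> C \<and> Suc d \<in> C) \<longleftrightarrow> y = Suc x" using xy by auto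
    ultimately show ?thesis using 3 by simp
  next
    case 4
    have "\<not> C \<subseteq> {i, Suc i}" for i
    proof
      assume "C \<subseteq> {i, Suc i}"
      then have "card C \<le> card {i, Suc i}" by (intro card_mono) auto
      then show False using 4 by simp
    qed
    then show ?thesis using 4 by simp
  qed
qed

text \<open>Both the number of non-cuts and the existence of two adjacent ones survive a permutation
  of the exponents.\<close>

lemma symmetric_coeffs_near_top:
  assumes n: "n \<ge> 1"
  shows "symmetric_coeffs n (near_top n)"
  unfolding symmetric_coeffs_def
proof (intro allI impI)
  fix \<sigma> :: "nat \<Rightarrow> nat" and a assume \<sigma>: "\<sigma> permutes {1..}" and w: "weight n a"
  define C where "C b = {1..n-1} - cuts n b" for b
  have s: "sum (near_top n) (Pow (cuts n b)) = int (card {i. i < n \<and> C b \<subseteq> {i, Suc i}})" for b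
    unfolding sum_near_top[OF finite_cuts] C_def
    by (intro arg_cong[where f=int] arg_cong[where f=card]) auto
  have cC: "card (C b) = n - 1 - card (cuts n b)" for b
    unfolding C_def using card_Diff_subset[of "cuts n b" "{1..n-1}"] by (simp add: cuts_def)
  have "card (cuts n (a \<circ> \<sigma>)) = card (cuts n a)"
    using card_cuts[OF w n] card_cuts[OF weight_comp[OF \<sigma> w] n] card_comp_permutes[OF \<sigma>, of a]
    by simp
  then have 1: "card (C (a \<circ> \<sigma>)) = card (C a)" by (simp add: cC)
  have "(\<exists>k. 3 \<le> (a \<circ> \<sigma>) k) \<longleftrightarrow> (\<exists>k. 3 \<le> a k)"
    using permutes_inverses[OF \<sigma>] by (metis comp_apply)
  then have 2: "(\<exists>d. d \<in> C (a \<circ> \<sigma>) \<and> Suc d \<in> C (a \<circ> \<sigma>)) \<longleftrightarrow> (\<exists>d. d \<in> C a \<and> Suc d \<in> C a)"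
    unfolding C_def adjacent_non_cuts_iff[OF w] adjacent_non_cuts_iff[OF weight_comp[OF \<sigma> w]] .
  have C: "C b \<subseteq> {1..n-1}" for b by (auto simp: C_def)
  show "sum (near_top n) (Pow (cuts n (a \<circ> \<sigma>))) = sum (near_top n) (Pow (cuts n a))"
    unfolding s card_adjacent_cover[OF C] 1 2 ..
qed

section \<open>Inserting the largest letter\<close>

text \<open>The descent set after inserting the letter \<open>n\<close> at position \<open>q\<close> into a permutation of
  \<open>{1..n-1}\<close> with descent set \<open>E\<close>.\<close>

definition shift_des :: "nat \<Rightarrow> nat \<Rightarrow> nat set \<Rightarrow> nat set" where
  "shift_des n q E = {d \<in> E. Suc d < q} \<union> {d. d = q \<and> q < n} \<union> Suc ` {d \<in> E. q \<le> d}"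

text \<open>The product with \<open>h_1\<close> in terms of coefficients: \<open>c\<close> lives on
  subsets of \<open>{1..n-2}\<close>, the result on subsets of \<open>{1..n-1}\<close>.\<close>

definition lift :: "nat \<Rightarrow> (nat set \<Rightarrow> int) \<Rightarrow> nat set \<Rightarrow> int" where
  "lift n c D = (\<Sum>E\<in>Pow {1..n-2}. \<Sum>q\<in>{1..n}. if shift_des n q E = D then c E else 0)"

lemma lift_diff: "lift n (\<lambda>E. c E - d E) D = lift n c D - lift n d D"
  unfolding lift_def sum_subtractf[symmetric] by (intro sum.cong refl) auto

lemma sum_lift:
  assumes "finite P"
  shows "sum (lift n c) (Pow P) =
    (\<Sum>E\<in>Pow {1..n-2}. \<Sum>q\<in>{1..n}. if shift_des n q E \<subseteq> P then c E else 0)"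
proof -
  have "sum (lift n c) (Pow P) = (\<Sum>E\<in>Pow {1..n-2}. \<Sum>D\<in>Pow P. \<Sum>q\<in>{1..n}.
      if shift_des n q E = D then c E else 0)"
    unfolding lift_def by (rule sum.swap)
  also have "\<dots> = (\<Sum>E\<in>Pow {1..n-2}. \<Sum>q\<in>{1..n}. \<Sum>D\<in>Pow P.
      if shift_des n q E = D then c E else 0)"
    by (intro sum.cong refl sum.swap)
  also have "\<dots> = (\<Sum>E\<in>Pow {1..n-2}. \<Sum>q\<in>{1..n}. if shift_des n q E \<subseteq> P then c E else 0)"
    using assms by (intro sum.cong refl) (simp add: sum.delta)
  finally show ?thesis .
qed

lemma shift_des_subset:
  assumes "E \<subseteq> {1..n-2}" "q \<in> {1..n}"
  shows "shift_des n q E \<subseteq> {1..n-1}"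
  using assms unfolding shift_des_def by fastforce

lemma total_lift: "sum (lift n c) (Pow {1..n-1}) = int n * sum c (Pow {1..n-2})"
proof -
  have "sum (lift n c) (Pow {1..n-1}) = (\<Sum>E\<in>Pow {1..n-2}. \<Sum>q\<in>{1..n}. c E)"
    unfolding sum_lift[OF finite_atLeastAtMost]
    by (intro sum.cong refl if_P shift_des_subset) auto
  then show ?thesis by (simp add: sum_distrib_left)
qed

definition decr :: "(nat \<Rightarrow> nat) \<Rightarrow> nat \<Rightarrow> (nat \<Rightarrow> nat)" where
  "decr a k = a(k := a k - 1)"

lemma psum_decr:
  assumes "a k \<noteq> 0"
  shows "psum (decr a k) m = (if m < k then psum a m else psum a m - 1)"
proof (cases "m < k")
  case True
  then show ?thesis unfolding psum_def decr_def by (auto intro!: sum.cong)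
next
  case False
  have "psum a m = a k + sum a ({..m} - {k})" "psum (decr a k) m = decr a k k + sum (decr a k) ({..m} - {k})"
    unfolding psum_def using False by (auto intro!: sum.remove)
  moreover have "sum (decr a k) ({..m} - {k}) = sum a ({..m} - {k})"
    by (intro sum.cong) (auto simp: decr_def)
  ultimately show ?thesis using False assms by (simp add: decr_def)
qed

lemma weight_decr:
  assumes "weight n a" "a k \<noteq> 0"
  shows "weight (n - 1) (decr a k)"
proof -
  let ?S = "{k. a k \<noteq> 0}"
  have fin: "finite ?S" using assms by (simp add: weight_def)
  have sub: "{j. decr a k j \<noteq> 0} \<subseteq> ?S" by (auto simp: decr_def)
  have "sum (decr a k) {j. decr a k j \<noteq> 0} = sum (decr a k) ?S"
    using fin sub by (intro sum.mono_neutral_left) auto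
  also have "\<dots> = decr a k k + sum (decr a k) (?S - {k})"
    using fin assms(2) by (intro sum.remove) auto
  also have "sum (decr a k) (?S - {k}) = sum a (?S - {k})"
    by (intro sum.cong) (auto simp: decr_def)
  also have "decr a k k + sum a (?S - {k}) = sum a ?S - 1"
    using sum.remove[OF fin, of k a] assms(2) by (simp add: decr_def)
  finally show ?thesis
    using assms finite_subset[OF sub fin] by (auto simp: weight_def decr_def)
qed

text \<open>In an arrangement whose descents lie in \<open>cuts n a\<close> the letter \<open>n\<close> ends one of the increasing
  blocks, of length \<open>a k\<close> say; deleting it shortens this block by one.\<close>

lemma shift_des_subset_cuts_iff:
  assumes w: "weight n a" and k: "a k \<noteq> 0" and E: "E \<subseteq> {1..n-2}"
  shows "shift_des n (psum a k) E \<subseteq> cuts n a \<longleftrightarrow> E \<subseteq> cuts (n - 1) (decr a k)"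
proof -
  define q where "q = psum a k"
  define R where "R = range (psum a)"
  obtain l where l: "k = Suc l" using w k by (cases k) (auto simp: weight_def)
  have lt: "psum a m < q" if "m < k" for m
    using psum_mono[of m l a] that k l by (simp add: q_def psum_Suc)
  have ge: "q \<le> psum a m" if "\<not> m < k" for m
    using psum_mono[of k m a] that by (simp add: q_def)
  have q: "1 \<le> q" "q \<le> n" using lt[of 0] l weight_psum_le[OF w] by (auto simp: q_def)
  have qR: "q \<in> R" by (simp add: q_def R_def)
  have dec: "d \<in> range (psum (decr a k)) \<longleftrightarrow> (d \<in> R \<and> d < q) \<or> (Suc d \<in> R \<and> q \<le> Suc d)" for d
  proof
    assume "d \<in> range (psum (decr a k))"
    then obtain m where m: "d = psum (decr a k) m" by auto
    show "(d \<in> R \<and> d < q) \<or> (Suc d \<in> R \<and> q \<le> Suc d)"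
    proof (cases "m < k")
      case True
      then show ?thesis using m lt by (simp add: psum_decr[of a, OF k] R_def)
    next
      case False
      then have "Suc d = psum a m" using m ge[of m] q by (simp add: psum_decr[of a, OF k])
      then show ?thesis using ge[OF False] by (simp add: R_def)
    qed
  next
    assume "(d \<in> R \<and> d < q) \<or> (Suc d \<in> R \<and> q \<le> Suc d)"
    then consider m where "psum a m = d" "d < q" | m where "psum a m = Suc d" "q \<le> Suc d"
      by (auto simp: R_def)
    then show "d \<in> range (psum (decr a k))"
    proof cases
      case (1 m)
      then have "psum (decr a k) m = d" using ge[of m] by (auto simp: psum_decr[of a, OF k])
      then show ?thesis by auto
    next
      case (2 m)
      then have "psum (decr a k) m = d" using lt[of m] by (auto simp: psum_decr[of a, OF k])
      then show ?thesis by auto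
    qed
  qed
  have c1: "shift_des n q E \<subseteq> cuts n a \<longleftrightarrow> (\<forall>d\<in>E. (Suc d < q \<longrightarrow> d \<in> R) \<and> (q \<le> d \<longrightarrow> Suc d \<in> R))"
    (is "?l \<longleftrightarrow> ?r")
  proof
    assume ?l
    then show ?r unfolding shift_des_def cuts_def R_def[symmetric] by blast
  next
    assume r: ?r
    have "x \<in> cuts n a" if "x \<in> shift_des n q E" for x
    proof -
      have "x \<in> {1..n-1}" using shift_des_subset[OF E, of q] q that by auto
      moreover have "x \<in> R" using that r qR by (auto simp: shift_des_def)
      ultimately show ?thesis by (simp add: cuts_def R_def)
    qed
    then show ?l by blast
  qed
  have "E \<subseteq> cuts (n - 1) (decr a k) \<longleftrightarrow> (\<forall>d\<in>E. (d \<in> R \<and> d < q) \<or> (Suc d \<in> R \<and> q \<le> Suc d))"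
  proof -
    have "n - 1 - 1 = n - 2" by simp
    then have "E \<subseteq> cuts (n - 1) (decr a k) \<longleftrightarrow> E \<subseteq> range (psum (decr a k))"
      using E by (simp add: cuts_def)
    also have "\<dots> \<longleftrightarrow> (\<forall>d\<in>E. d \<in> range (psum (decr a k)))" by (rule subset_iff[unfolded Ball_def[symmetric]])
    finally show ?thesis unfolding dec .
  qed
  also have "\<dots> \<longleftrightarrow> (\<forall>d\<in>E. (Suc d < q \<longrightarrow> d \<in> R) \<and> (q \<le> d \<longrightarrow> Suc d \<in> R))"
  proof (intro ball_cong refl)
    fix d
    consider "Suc d < q" | "Suc d = q" | "q \<le> d" by linarith
    then show "((d \<in> R \<and> d < q) \<or> (Suc d \<in> R \<and> q \<le> Suc d)) \<longleftrightarrow>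
        ((Suc d < q \<longrightarrow> d \<in> R) \<and> (q \<le> d \<longrightarrow> Suc d \<in> R))"
      by cases (use qR in auto)
  qed
  finally show ?thesis using c1 q_def by simp
qed

text \<open>The product with \<open>h_1\<close>, read off monomial by monomial: the factor
  \<open>h_1\<close> supplies one occurrence of some letter \<open>k\<close>.\<close>

lemma sum_lift_cuts:
  assumes w: "weight n a" and n: "n \<ge> 1"
  shows "sum (lift n c) (Pow (cuts n a)) =
    (\<Sum>k\<in>{k. a k \<noteq> 0}. sum c (Pow (cuts (n - 1) (decr a k))))"
proof -
  let ?g = "\<lambda>E q. if shift_des n q E \<subseteq> cuts n a then c E else 0"
  have bij: "bij_betw (psum a) {k. a k \<noteq> 0} (insert n (cuts n a))"
    by (rule bij_betw_psum[OF w n])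
  have "(\<Sum>q\<in>{1..n}. ?g E q) =
      (\<Sum>k\<in>{k. a k \<noteq> 0}. if E \<subseteq> cuts (n - 1) (decr a k) then c E else 0)"
    if E: "E \<in> Pow {1..n-2}" for E
  proof -
    \<comment> \<open>An insertion position \<open>q < n\<close> becomes a descent, so only cuts and
      \<open>q = n\<close> contribute.\<close>
    have "(\<Sum>q\<in>{1..n}. ?g E q) = (\<Sum>q\<in>insert n (cuts n a). ?g E q)"
    proof (rule sum.mono_neutral_right)
      show "insert n (cuts n a) \<subseteq> {1..n}" using n by (auto simp: cuts_def)
      show "\<forall>q\<in>{1..n} - insert n (cuts n a). ?g E q = 0" by (auto simp: shift_des_def)
    qed simp
    also have "\<dots> = (\<Sum>k\<in>{k. a k \<noteq> 0}. ?g E (psum a k))"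
      by (rule sum.reindex_bij_betw[OF bij, symmetric])
    also have "\<dots> = (\<Sum>k\<in>{k. a k \<noteq> 0}. if E \<subseteq> cuts (n - 1) (decr a k) then c E else 0)"
      using shift_des_subset_cuts_iff[OF w] E by (intro sum.cong refl) auto
    finally show ?thesis .
  qed
  then have "sum (lift n c) (Pow (cuts n a)) =
      (\<Sum>E\<in>Pow {1..n-2}. \<Sum>k\<in>{k. a k \<noteq> 0}. if E \<subseteq> cuts (n - 1) (decr a k) then c E else 0)"
    unfolding sum_lift[OF finite_cuts] by (rule sum.cong[OF refl])
  also have "\<dots> = (\<Sum>k\<in>{k. a k \<noteq> 0}. \<Sum>E\<in>Pow {1..n-2}. if E \<subseteq> cuts (n - 1) (decr a k) then c E else 0)"
    by (rule sum.swap)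
  also have "\<dots> = (\<Sum>k\<in>{k. a k \<noteq> 0}. sum c (Pow (cuts (n - 1) (decr a k))))"
  proof (rule sum.cong[OF refl])
    fix k
    have "n - 1 - 1 = n - 2" by simp
    then have "cuts (n - 1) (decr a k) \<subseteq> {1..n-2}" unfolding cuts_def by simp
    then have e: "Pow {1..n-2} \<inter> {E. E \<subseteq> cuts (n - 1) (decr a k)} = Pow (cuts (n - 1) (decr a k))"
      by blast
    show "(\<Sum>E\<in>Pow {1..n-2}. if E \<subseteq> cuts (n - 1) (decr a k) then c E else 0) =
        sum c (Pow (cuts (n - 1) (decr a k)))"
      unfolding e[symmetric] by (simp only: sum.inter_restrict finite_Pow_iff finite_atLeastAtMost mem_Collect_eq)
  qed
  finally show ?thesis .
qed

text \<open>Permuting the exponents permutes the terms of \<open>sum_lift_cuts\<close>: removing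
  \<open>k\<close> from \<open>a \<circ> \<sigma>\<close> amounts to removing
  \<open>\<sigma> k\<close> from \<open>a\<close>.\<close>

lemma symmetric_coeffs_lift:
  assumes c: "symmetric_coeffs (n - 1) c" and n: "n \<ge> 1"
  shows "symmetric_coeffs n (lift n c)"
  unfolding symmetric_coeffs_def
proof (intro allI impI)
  fix \<sigma> :: "nat \<Rightarrow> nat" and a assume \<sigma>: "\<sigma> permutes {1..}" and w: "weight n a"
  have d: "decr (a \<circ> \<sigma>) k = decr a (\<sigma> k) \<circ> \<sigma>" for k
    using permutes_inj[OF \<sigma>] by (auto simp: decr_def fun_eq_iff inj_eq)
  have bij: "bij_betw \<sigma> {k. (a \<circ> \<sigma>) k \<noteq> 0} {k. a k \<noteq> 0}"
  proof (rule bij_betw_imageI)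
    show "inj_on \<sigma> {k. (a \<circ> \<sigma>) k \<noteq> 0}"
      using permutes_inj[OF \<sigma>] inj_on_subset by blast
    show "\<sigma> ` {k. (a \<circ> \<sigma>) k \<noteq> 0} = {k. a k \<noteq> 0}"
    proof
      show "{k. a k \<noteq> 0} \<subseteq> \<sigma> ` {k. (a \<circ> \<sigma>) k \<noteq> 0}"
      proof
        fix k assume "k \<in> {k. a k \<noteq> 0}"
        then show "k \<in> \<sigma> ` {k. (a \<circ> \<sigma>) k \<noteq> 0}"
          by (intro image_eqI[of _ _ "inv \<sigma> k"]) (simp_all add: permutes_inverses[OF \<sigma>])
      qed
    qed auto
  qed
  have "sum (lift n c) (Pow (cuts n (a \<circ> \<sigma>))) =
      (\<Sum>k\<in>{k. (a \<circ> \<sigma>) k \<noteq> 0}. sum c (Pow (cuts (n - 1) (decr a (\<sigma> k) \<circ> \<sigma>))))"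
    unfolding sum_lift_cuts[OF weight_comp[OF \<sigma> w] n] d ..
  also have "\<dots> = (\<Sum>k\<in>{k. (a \<circ> \<sigma>) k \<noteq> 0}. sum c (Pow (cuts (n - 1) (decr a (\<sigma> k)))))"
  proof (rule sum.cong[OF refl])
    fix k assume "k \<in> {k. (a \<circ> \<sigma>) k \<noteq> 0}"
    then have "weight (n - 1) (decr a (\<sigma> k))" using weight_decr[OF w] by simp
    then show "sum c (Pow (cuts (n - 1) (decr a (\<sigma> k) \<circ> \<sigma>))) = sum c (Pow (cuts (n - 1) (decr a (\<sigma> k))))"
      using c \<sigma> by (simp add: symmetric_coeffs_def)
  qed
  also have "\<dots> = (\<Sum>k\<in>{k. a k \<noteq> 0}. sum c (Pow (cuts (n - 1) (decr a k))))"
    by (rule sum.reindex_bij_betw[OF bij])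
  also have "\<dots> = sum (lift n c) (Pow (cuts n a))"
    by (rule sum_lift_cuts[OF w n, symmetric])
  finally show "sum (lift n c) (Pow (cuts n (a \<circ> \<sigma>))) = sum (lift n c) (Pow (cuts n a))" .
qed

section \<open>Numbers of permutations with a given descent set\<close>

definition beta :: "nat \<Rightarrow> nat set \<Rightarrow> int" where
  "beta n D = int (card {w. w permutes {1..n} \<and> Des n w = D})"

definition insert_max :: "nat \<Rightarrow> nat \<Rightarrow> (nat \<Rightarrow> nat) \<Rightarrow> (nat \<Rightarrow> nat)" where
  "insert_max n q w = (\<lambda>i. if i < q then w i else if i = q then n else if i \<le> n then w (i - 1) else i)"

lemma Des_subset: "Des n w \<subseteq> {1..n-1}"
  by (auto simp: Des_def)

lemma Des_pred_subset: "Des (n - 1) w \<subseteq> {1..n-2}"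
  using Des_subset[of "n - 1" w] by (simp only: diff_diff_left one_add_one)

lemma permutes_less:
  fixes n i :: nat
  assumes "w permutes {1..n-1}" "1 \<le> i" "i < n"
  shows "w i < n"
proof -
  have "i \<in> {1..n-1}" using assms(2,3) by simp
  then have "w i \<in> {1..n-1}" by (simp only: permutes_in_image[OF assms(1)])
  then show ?thesis using assms(2,3) by auto
qed

text \<open>The letter \<open>n\<close> creates an ascent before it and, unless it is last, a
  descent after it. The comparison it interrupts is lost, and later ones move by one.\<close>

lemma Des_insert_max:
  assumes w: "w permutes {1..n-1}" and q: "q \<in> {1..n}"
  shows "Des n (insert_max n q w) = shift_des n q (Des (n - 1) w)"
proof (rule set_eqI)
  fix i
  show "i \<in> Des n (insert_max n q w) \<longleftrightarrow> i \<in> shift_des n q (Des (n - 1) w)"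
  proof (cases "1 \<le> i \<and> i < n")
    case True
    consider "Suc i < q" | "Suc i = q" | "i = q" | d where "i = Suc d" "q \<le> d"
      by (metis Suc_lessI linorder_neqE_nat less_imp_Suc_add le_add1 add_Suc_right)
    then show ?thesis
    proof cases
      case 1
      then show ?thesis using True q by (auto simp: Des_def shift_des_def insert_max_def)
    next
      case 2
      then show ?thesis using True q permutes_less[OF w, of i]
        by (auto simp: Des_def shift_des_def insert_max_def)
    next
      case 3
      then show ?thesis using True q permutes_less[OF w, of i]
        by (auto simp: Des_def shift_des_def insert_max_def)
    next
      case (4 d)
      then show ?thesis using True q by (auto simp: Des_def shift_des_def insert_max_def)
    qed
  next
    case False
    have "shift_des n q (Des (n - 1) w) \<subseteq> {1..n-1}"
      by (rule shift_des_subset[OF Des_pred_subset q])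
    moreover have "i \<notin> {1..n-1}" using False by auto
    ultimately show ?thesis using Des_subset[of n "insert_max n q w"] by blast
  qed
qed

lemma insert_max_permutes:
  assumes w: "w permutes {1..n-1}" and q: "q \<in> {1..n}"
  shows "insert_max n q w permutes {1..n}"
proof (rule bij_imp_permutes)
  have inj: "inj_on (insert_max n q w) {1..n}"
  proof (rule inj_onI)
    fix x y assume x: "x \<in> {1..n}" and y: "y \<in> {1..n}" and e: "insert_max n q w x = insert_max n q w y"
    have "w (if x < q then x else x - 1) < n" if "x \<noteq> q" "x \<in> {1..n}" for x
      using that q by (intro permutes_less[OF w]) auto
    from this[of x] this[of y] show "x = y"
      using x y e q permutes_inj[OF w]
      by (auto simp: insert_max_def inj_eq split: if_splits)
  qed
  moreover have "insert_max n q w ` {1..n} \<subseteq> {1..n}"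
  proof
    fix y assume "y \<in> insert_max n q w ` {1..n}"
    then obtain x where x: "x \<in> {1..n}" "y = insert_max n q w x" by auto
    have "w (if x < q then x else x - 1) \<in> {1..n-1}" if "x \<noteq> q"
      using that q x by (subst permutes_in_image[OF w]) auto
    then show "y \<in> {1..n}" using x q by (auto simp: insert_max_def)
  qed
  ultimately show "bij_betw (insert_max n q w) {1..n} {1..n}"
    unfolding bij_betw_def by (simp add: endo_inj_surj)
qed (use q in \<open>auto simp: insert_max_def intro: permutes_not_in[OF w]\<close>)

lemma inj_on_insert_max:
  "inj_on (\<lambda>(w, q). insert_max n q w) ({w. w permutes {1..n-1}} \<times> {1..n})"
proof (rule inj_onI, clarify)
  fix w q w' q'
  assume w: "w permutes {1..n-1}" and w': "w' permutes {1..n-1}"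
    and q: "q \<in> {1..n}" and q': "q' \<in> {1..n}" and e: "insert_max n q w = insert_max n q' w'"
  have ev: "insert_max n q w i = insert_max n q' w' i" for i by (simp add: e)
  have "q' = q"
  proof (rule ccontr)
    assume "q' \<noteq> q"
    then have "w' (if q < q' then q else q - 1) < n"
      using q q' by (intro permutes_less[OF w']) auto
    then show False using ev[of q] \<open>q' \<noteq> q\<close> q q' by (auto simp: insert_max_def split: if_splits)
  qed
  moreover have "w i = w' i" for i
  proof -
    consider "i < q" | "q \<le> i" "i < n" | "n \<le> i" by linarith
    then show ?thesis
    proof cases
      case 1
      then show ?thesis using ev[of i] \<open>q' = q\<close> by (simp add: insert_max_def)
    next
      case 2
      then show ?thesis using ev[of "Suc i"] \<open>q' = q\<close> by (simp add: insert_max_def)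
    next
      case 3
      then have "i \<notin> {1..n-1}" using q by auto
      then show ?thesis using permutes_not_in[OF w] permutes_not_in[OF w'] by simp
    qed
  qed
  ultimately show "w = w' \<and> q = q'" by auto
qed

text \<open>Inclusion together with equal cardinality, from \<open>n! = n (n - 1)!\<close>, avoids
  an explicit deletion map.\<close>

lemma insert_max_image:
  assumes "n \<ge> 1"
  shows "(\<lambda>(w, q). insert_max n q w) ` ({w. w permutes {1..n-1}} \<times> {1..n}) = {w. w permutes {1..n}}"
proof (rule card_subset_eq)
  show "finite {w. w permutes {1..n}}" by (simp add: finite_permutations)
  show "(\<lambda>(w, q). insert_max n q w) ` ({w. w permutes {1..n-1}} \<times> {1..n}) \<subseteq> {w. w permutes {1..n}}"
    using insert_max_permutes by auto
  have "card {w. w permutes {1..n-1}} = fact (n - 1)" "card {w. w permutes {1..n}} = fact n"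
    by (intro card_permutations; simp)+
  then show "card ((\<lambda>(w, q). insert_max n q w) ` ({w. w permutes {1..n-1}} \<times> {1..n})) =
      card {w. w permutes {1..n}}"
    unfolding card_image[OF inj_on_insert_max] using assms
    by (simp add: card_cartesian_product fact_reduce mult.commute)
qed

text \<open>This recursion lets lower bounds for \<open>beta\<close> be proved by exhibiting
  insertions, and lets \<open>lift\<close> be compared with \<open>beta\<close>.\<close>

lemma beta_lift:
  assumes n: "n \<ge> 1"
  shows "beta n D = lift n (beta (n - 1)) D"
proof -
  let ?S = "{w. w permutes {1..n-1}}" and ?F = "\<lambda>(w, q). insert_max n q w"
  let ?g = "\<lambda>q E. if shift_des n q E = D then 1 else 0 :: int"
  have fin: "finite ?S" by (simp add: finite_permutations)
  have "{w. w permutes {1..n} \<and> Des n w = D} = {w \<in> ?F ` (?S \<times> {1..n}). Des n w = D}"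
    unfolding insert_max_image[OF n] by simp
  also have "\<dots> = ?F ` {x \<in> ?S \<times> {1..n}. shift_des n (snd x) (Des (n - 1) (fst x)) = D}"
    using Des_insert_max[of _ n] by (auto simp: image_iff)
  finally have "beta n D = int (card (?F ` {x \<in> ?S \<times> {1..n}. shift_des n (snd x) (Des (n - 1) (fst x)) = D}))"
    by (simp add: beta_def)
  also have "\<dots> = int (card {x \<in> ?S \<times> {1..n}. shift_des n (snd x) (Des (n - 1) (fst x)) = D})"
    by (subst card_image) (auto intro: inj_on_subset[OF inj_on_insert_max])
  also have "\<dots> = (\<Sum>x\<in>?S \<times> {1..n}. ?g (snd x) (Des (n - 1) (fst x)))"
    using fin by (simp add: sum.inter_filter[symmetric])
  also have "\<dots> = (\<Sum>w\<in>?S. \<Sum>q\<in>{1..n}. ?g q (Des (n - 1) w))"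
    by (simp add: sum.cartesian_product split_def)
  also have "\<dots> = (\<Sum>E\<in>Pow {1..n-2}. \<Sum>w\<in>{w \<in> ?S. Des (n - 1) w = E}. \<Sum>q\<in>{1..n}. ?g q (Des (n - 1) w))"
  proof (rule sum.group[symmetric])
    show "Des (n - 1) ` ?S \<subseteq> Pow {1..n-2}" using Des_pred_subset by blast
  qed (use fin in auto)
  also have "\<dots> = lift n (beta (n - 1)) D"
    unfolding lift_def
  proof (rule sum.cong[OF refl])
    fix E
    have "(\<Sum>w\<in>{w \<in> ?S. Des (n - 1) w = E}. \<Sum>q\<in>{1..n}. ?g q (Des (n - 1) w)) =
        (\<Sum>w\<in>{w \<in> ?S. Des (n - 1) w = E}. \<Sum>q\<in>{1..n}. ?g q E)"
      by (rule sum.cong[OF refl]) simp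
    also have "\<dots> = beta (n - 1) E * (\<Sum>q\<in>{1..n}. ?g q E)"
      by (simp add: beta_def)
    also have "\<dots> = (\<Sum>q\<in>{1..n}. if shift_des n q E = D then beta (n - 1) E else 0)"
      unfolding sum_distrib_left by (rule sum.cong[OF refl]) simp
    finally show "(\<Sum>w\<in>{w \<in> ?S. Des (n - 1) w = E}. \<Sum>q\<in>{1..n}. ?g q (Des (n - 1) w)) =
        (\<Sum>q\<in>{1..n}. if shift_des n q E = D then beta (n - 1) E else 0)" .
  qed
  finally show ?thesis .
qed

lemma beta_nonneg: "0 \<le> beta n D"
  by (simp add: beta_def)

section \<open>Complementing values and descent sets\<close>

lemma delta_delta [simp]: "delta n (delta n i) = i"
  by (auto simp: delta_def)

lemma delta_permutes: "delta n permutes {1..n}"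
proof (rule bij_imp_permutes)
  show "bij_betw (delta n) {1..n} {1..n}"
    by (rule bij_betw_byWitness[where f' = "delta n"]) (auto simp: delta_def)
qed (auto simp: delta_def)

lemma Des_delta_comp:
  assumes w: "w permutes {1..n}"
  shows "Des n (delta n \<circ> w) = {1..n-1} - Des n w"
proof -
  have "delta n (w i) > delta n (w (Suc i)) \<longleftrightarrow> \<not> w i > w (Suc i)" if "i \<in> {1..n-1}" for i
  proof -
    have "w i \<in> {1..n}" "w (Suc i) \<in> {1..n}"
      using that by (subst permutes_in_image[OF w]; auto)+
    moreover have "w i \<noteq> w (Suc i)" using permutes_inj[OF w] by (auto simp: inj_eq)
    ultimately show ?thesis by (auto simp: delta_def)
  qed
  then show ?thesis by (auto simp: Des_def)
qed

text \<open>Composition with \<open>delta n\<close> exchanges ascents and descents. Bounds for small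
  descent sets thus carry over to large ones.\<close>

lemma beta_Compl:
  assumes D: "D \<subseteq> {1..n-1}"
  shows "beta n ({1..n-1} - D) = beta n D"
proof -
  have "bij_betw (\<lambda>w. delta n \<circ> w) {w. w permutes {1..n} \<and> Des n w = D}
      {w. w permutes {1..n} \<and> Des n w = {1..n-1} - D}"
  proof (rule bij_betw_byWitness[where f' = "\<lambda>w. delta n \<circ> w"])
    show "(\<lambda>w. delta n \<circ> w) ` {w. w permutes {1..n} \<and> Des n w = D}
        \<subseteq> {w. w permutes {1..n} \<and> Des n w = {1..n-1} - D}"
      using permutes_compose[OF _ delta_permutes] Des_delta_comp by auto
    have "{1..n-1} - ({1..n-1} - D) = D" using D by blast
    then show "(\<lambda>w. delta n \<circ> w) ` {w. w permutes {1..n} \<and> Des n w = {1..n-1} - D}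
        \<subseteq> {w. w permutes {1..n} \<and> Des n w = D}"
      using permutes_compose[OF _ delta_permutes] Des_delta_comp by auto
  qed (auto simp: fun_eq_iff)
  from bij_betw_same_card[OF this] show ?thesis by (simp only: beta_def)
qed

lemma beta_ge_1:
  assumes "w permutes {1..n}" "Des n w = D"
  shows "1 \<le> beta n D"
proof -
  have "finite {w. w permutes {1..n} \<and> Des n w = D}"
    by (rule finite_subset[OF _ finite_permutations[of "{1..n}"]]) auto
  moreover have "w \<in> {w. w permutes {1..n} \<and> Des n w = D}" using assms by simp
  ultimately have "card {w. w permutes {1..n} \<and> Des n w = D} \<noteq> 0" by (metis card_0_eq empty_iff)
  then show ?thesis by (simp add: beta_def)
qed

lemma Des_id: "Des n id = {}"
  by (auto simp: Des_def)

lemma Des_delta: "Des n (delta n) = {1..n-1}"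
  using Des_delta_comp[OF permutes_id, of n] by (simp add: Des_id)

section \<open>Values and lower bounds of lifts\<close>

lemma lift_eq_sum:
  "lift n c D = (\<Sum>x\<in>{x \<in> Pow {1..n-2} \<times> {1..n}. shift_des n (snd x) (fst x) = D}. c (fst x))"
proof -
  have "lift n c D = (\<Sum>x\<in>Pow {1..n-2} \<times> {1..n}. if shift_des n (snd x) (fst x) = D then c (fst x) else 0)"
    unfolding lift_def by (simp add: sum.cartesian_product split_def)
  then show ?thesis by (simp add: sum.inter_filter[symmetric])
qed

text \<open>Any listed pairs \<open>(E, q)\<close> producing \<open>D\<close> give a lower bound,
  since the other terms are nonnegative.\<close>

lemma lift_ge_sum:
  assumes "\<And>E. E \<subseteq> {1..n-2} \<Longrightarrow> 0 \<le> c E"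
    and "\<And>x. x \<in> X \<Longrightarrow> fst x \<subseteq> {1..n-2} \<and> snd x \<in> {1..n} \<and> shift_des n (snd x) (fst x) = D"
  shows "(\<Sum>x\<in>X. c (fst x)) \<le> lift n c D"
  unfolding lift_eq_sum
proof (rule sum_mono2)
  show "X \<subseteq> {x \<in> Pow {1..n-2} \<times> {1..n}. shift_des n (snd x) (fst x) = D}"
    using assms(2) by (simp only: subset_iff mem_Collect_eq mem_Times_iff Pow_iff) blast
qed (auto intro!: assms(1))

lemma lift_nonneg:
  assumes "\<And>E. E \<subseteq> {1..n-2} \<Longrightarrow> 0 \<le> c E"
  shows "0 \<le> lift n c D"
  unfolding lift_eq_sum using assms by (intro sum_nonneg) auto

lemma lift_empty:
  assumes "c {} = 0"
  shows "lift n c {} = 0"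
  unfolding lift_eq_sum
proof (rule sum.neutral, clarify)
  fix E q assume E: "E \<subseteq> {1..n-2}" and q: "q \<in> {1..n}" and s: "shift_des n (snd (E, q)) (fst (E, q)) = {}"
  have "q = n" using s q by (auto simp: shift_des_def)
  have "E = {}"
  proof (rule ccontr)
    assume "E \<noteq> {}"
    then obtain d where "d \<in> E" by blast
    then have "d \<in> shift_des n q E" using E \<open>q = n\<close> by (fastforce simp: shift_des_def)
    then show False using s by simp
  qed
  then show "c (fst (E, q)) = 0" using assms by simp
qed

lemma lift_full:
  assumes "c {1..n-2} = 0" "n \<ge> 2"
  shows "lift n c {1..n-1} = 0"
  unfolding lift_eq_sum
proof (rule sum.neutral, clarify)
  fix E q assume E: "E \<subseteq> {1..n-2}" and q: "q \<in> {1..n}"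
    and s: "shift_des n (snd (E, q)) (fst (E, q)) = {1..n-1}"
  \<comment> \<open>The step into the letter \<open>n\<close> is an ascent, so it must not exist:
    \<open>n\<close> stands first.\<close>
  have "q - 1 \<notin> shift_des n q E" using q by (auto simp: shift_des_def)
  then have "q = 1" using s q by auto
  have "d \<in> E" if "d \<in> {1..n-2}" for d
  proof -
    have "Suc d \<in> shift_des n q E" using s that by auto
    then show ?thesis using \<open>q = 1\<close> that by (auto simp: shift_des_def)
  qed
  then have "E = {1..n-2}" using E by blast
  then show "c (fst (E, q)) = 0" using assms by simp
qed

text \<open>There are just two insertions here, which is why \<open>{1}\<close> controls the other
  singletons in \<open>balanced\<close>.\<close>

lemma lift_first:
  assumes n: "n \<ge> 3"
  shows "lift n c {1} = c {1} + c {}"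
proof -
  have "{x \<in> Pow {1..n-2} \<times> {1..n}. shift_des n (snd x) (fst x) = {1}} = {({1}, n), ({}, 1)}"
  proof (intro equalityI subsetI)
    fix x assume "x \<in> {x \<in> Pow {1..n-2} \<times> {1..n}. shift_des n (snd x) (fst x) = {1}}"
    then obtain E q where x: "x = (E, q)" and E: "E \<subseteq> {1..n-2}" and q: "q \<in> {1..n}"
      and s: "shift_des n q E = {1}" by (cases x) auto
    show "x \<in> {({1}, n), ({}, 1)}"
    proof (cases "q = n")
      case True
      have "shift_des n n E = E" using E n by (fastforce simp: shift_des_def)
      then show ?thesis using True s x by simp
    next
      case False
      then have "q \<in> shift_des n q E" using q by (auto simp: shift_des_def)
      then have "q = 1" using s by simp
      moreover have "d \<notin> E" for d
      proof
        assume d: "d \<in> E"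
        then have "1 \<le> d" using E by auto
        then have "Suc d \<in> shift_des n q E" using d \<open>q = 1\<close> by (auto simp: shift_des_def)
        then show False using s \<open>1 \<le> d\<close> by simp
      qed
      ultimately show ?thesis using x by auto
    qed
  qed (use n in \<open>auto simp: shift_des_def\<close>)
  then show ?thesis using n unfolding lift_eq_sum by simp
qed

text \<open>Append \<open>n\<close> if \<open>i \<le> n - 2\<close>, and put it before the last
  letter if \<open>i = n - 1\<close>; \<open>min\<close> merges both cases. The second term inserts
  \<open>n\<close> at \<open>i\<close> into an increasing word.\<close>

lemma lift_singleton_ge:
  assumes n: "n \<ge> 3" and i: "i \<in> {1..n-1}" and c: "\<And>E. E \<subseteq> {1..n-2} \<Longrightarrow> 0 \<le> c E"
  shows "c {min i (n-2)} + c {} \<le> lift n c {i}"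
proof -
  define X where "X = {({min i (n-2)}, if i \<le> n-2 then n else i), ({}::nat set, i)}"
  have "(\<Sum>x\<in>X. c (fst x)) \<le> lift n c {i}"
    by (rule lift_ge_sum[OF c])
      (use n i in \<open>auto simp: X_def shift_des_def min_def split: if_splits\<close>)
  then show ?thesis by (simp add: X_def)
qed

text \<open>An interior \<open>i\<close> admits a further insertion, at \<open>i\<close> into a word
  with descent \<open>i - 1\<close>.\<close>

lemma lift_interior_singleton_ge:
  assumes i: "2 \<le> i" "i \<le> n-2" and c: "\<And>E. E \<subseteq> {1..n-2} \<Longrightarrow> 0 \<le> c E"
  shows "c {i} + c {i-1} + c {} \<le> lift n c {i}"
proof -
  define X where "X = {({i}, n), ({i-1}, i), ({}::nat set, i)}"
  have "(\<Sum>x\<in>X. c (fst x)) \<le> lift n c {i}"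
    by (rule lift_ge_sum[OF c]) (use i in \<open>auto simp: X_def shift_des_def\<close>)
  moreover have "i - 1 \<noteq> i" using i by simp
  ultimately show ?thesis using i by (simp add: X_def)
qed

lemma lift_pair_ge:
  assumes i: "1 \<le> i" "i < j" "j \<le> n-1" and c: "\<And>E. E \<subseteq> {1..n-2} \<Longrightarrow> 0 \<le> c E"
  shows "c {j-1} \<le> lift n c {i, j}"
proof -
  have "(\<Sum>x\<in>{({j-1}, i)}. c (fst x)) \<le> lift n c {i, j}"
    by (rule lift_ge_sum[OF c]) (use i in \<open>auto simp: shift_des_def\<close>)
  then show ?thesis by simp
qed

lemma lift_pair_ge2:
  assumes n: "n \<ge> 4" and i: "1 \<le> i" "i < j" "j \<le> n-1" and c: "\<And>E. E \<subseteq> {1..n-2} \<Longrightarrow> 0 \<le> c E"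
  shows "\<exists>i' j'. 1 \<le> i' \<and> i' < j' \<and> j' \<le> n-2 \<and> c {i', j'} + c {j-1} \<le> lift n c {i, j}"
proof -
  \<comment> \<open>To obtain \<open>{i, j}\<close> from two descents, append \<open>n\<close> if
    \<open>j < n - 1\<close>. Otherwise insert it at \<open>n - 1\<close>, or at
    \<open>n - 2\<close> if \<open>i = n - 2\<close>.\<close>
  define i' where "i' = (if j = n-1 \<and> i = n-2 then n-3 else i)"
  define j' where "j' = (if j = n-1 then n-2 else j)"
  define q where "q = (if j = n-1 then if i = n-2 then n-2 else n-1 else n)"
  define X where "X = {({i', j'}, q), ({j-1}, i)}"
  have ij: "1 \<le> i'" "i' < j'" "j' \<le> n-2" using n i by (auto simp: i'_def j'_def)
  have ne: "{i', j'} \<noteq> {j-1}" using ij by auto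
  have s1: "shift_des n q {i', j'} = {i, j}"
  proof -
    obtain m where m: "n = m + 4" using n by (metis add.commute le_Suc_ex)
    consider "j = n-1" "i = n-2" | "j = n-1" "i < n-2" | "j < n-1" using i by linarith
    then show ?thesis
      by cases (use i in \<open>auto simp: m i'_def j'_def q_def shift_des_def image_iff\<close>)
  qed
  have q: "q \<in> {1..n}" using n by (auto simp: q_def)
  have s2: "shift_des n i {j-1} = {i, j}" using i by (auto simp: shift_des_def)
  have "(\<Sum>x\<in>X. c (fst x)) \<le> lift n c {i, j}"
  proof (rule lift_ge_sum[OF c])
    fix x assume "x \<in> X"
    then consider "x = ({i', j'}, q)" | "x = ({j-1}, i)" by (auto simp: X_def)
    then show "fst x \<subseteq> {1..n-2} \<and> snd x \<in> {1..n} \<and> shift_des n (snd x) (fst x) = {i, j}"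
      by cases (use ij q i s1 s2 in auto)
  qed
  moreover have "(\<Sum>x\<in>X. c (fst x)) = c {i', j'} + c {j-1}"
  proof -
    have "({i', j'}, q) \<notin> {({j-1}, i)}" using ne by blast
    then have "(\<Sum>x\<in>X. c (fst x)) = c (fst ({i', j'}, q)) + (\<Sum>x\<in>{({j-1}, i)}. c (fst x))"
      unfolding X_def by (rule sum.insert[rotated]) simp
    then show ?thesis by simp
  qed
  ultimately show ?thesis using ij by metis
qed

section \<open>Lower bounds for descent classes\<close>

lemma beta_empty_ge: "1 \<le> beta n {}"
  by (rule beta_ge_1[OF permutes_id Des_id])

lemma beta_singleton_ge:
  "n \<ge> 2 \<Longrightarrow> i \<in> {1..n-1} \<Longrightarrow> int n - 1 \<le> beta n {i}"
proof (induction n arbitrary: i rule: nat_induct_at_least)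
  case base
  then have "{i} = {1..2-1}" by auto
  then show ?case using beta_ge_1[OF delta_permutes Des_delta, of 2] by simp
next
  case (Suc n)
  have "beta n {min i (Suc n - 2)} + beta n {} \<le> lift (Suc n) (beta n) {i}"
    using Suc by (intro lift_singleton_ge beta_nonneg) auto
  moreover have "int n - 1 \<le> beta n {min i (Suc n - 2)}" using Suc.prems Suc.hyps by (intro Suc.IH) auto
  ultimately show ?case using beta_empty_ge[of n] beta_lift[of "Suc n" "{i}"] by simp
qed

text \<open>In each insertion step the class of \<open>{1}\<close> grows by exactly
  \<open>beta n {}\<close>, while the bound for any other singleton grows by at least as
  much.\<close>

lemma beta_singleton_min:
  assumes "n \<ge> 2" "i \<in> {1..n-1}"
  shows "beta n {1} \<le> beta n {i}"
  using assms
proof (induction n arbitrary: i rule: nat_induct_at_least)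
  case base
  then show ?case by simp
next
  case (Suc n)
  have "beta n {min i (Suc n - 2)} + beta n {} \<le> lift (Suc n) (beta n) {i}"
    using Suc by (intro lift_singleton_ge beta_nonneg) auto
  moreover have "beta n {1} \<le> beta n {min i (Suc n - 2)}" using Suc.prems Suc.hyps by (intro Suc.IH) auto
  moreover have "lift (Suc n) (beta n) {1} = beta n {1} + beta n {}" using Suc by (intro lift_first) simp
  ultimately show ?case using beta_lift[of "Suc n"] by simp
qed

text \<open>Pascal's rule: the two insertions of \<open>lift_pair_ge2\<close> contribute a pair
  class and a singleton class for one letter less.\<close>

lemma beta_pair_ge:
  "n \<ge> 3 \<Longrightarrow> 1 \<le> i \<Longrightarrow> i < j \<Longrightarrow> j \<le> n-1 \<Longrightarrow> int ((n-1) choose 2) \<le> beta n {i, j}"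
proof (induction n arbitrary: i j rule: nat_induct_at_least)
  case base
  then have "{i, j} = {1..3-1}" by auto
  then show ?case using beta_ge_1[OF delta_permutes Des_delta, of 3] by simp
next
  case (Suc n)
  obtain i' j' where ij: "1 \<le> i'" "i' < j'" "j' \<le> Suc n - 2"
    "beta n {i', j'} + beta n {j-1} \<le> lift (Suc n) (beta n) {i, j}"
    using lift_pair_ge2[of "Suc n" i j "beta n"] beta_nonneg Suc by auto
  have "int ((n-1) choose 2) \<le> beta n {i', j'}" using ij by (intro Suc.IH) auto
  moreover have "int n - 1 \<le> beta n {j-1}" using Suc.prems Suc.hyps by (intro beta_singleton_ge) auto
  moreover have "int (n choose 2) = int ((n-1) choose 2) + (int n - 1)"
    using Suc.hyps by (cases n) (auto simp: numeral_2_eq_2)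
  ultimately show ?case using ij(4) beta_lift[of "Suc n" "{i, j}"] by simp
qed

section \<open>Realising coefficient functions by sets of permutations\<close>

text \<open>\<open>c\<close> prescribes how many permutations to take from each descent class. The
  two zero values exclude \<open>iota n\<close> and \<open>delta n\<close>.\<close>

definition feasible :: "nat \<Rightarrow> (nat set \<Rightarrow> int) \<Rightarrow> bool" where
  "feasible n c \<longleftrightarrow> symmetric_coeffs n c \<and> (\<forall>D\<subseteq>{1..n-1}. 0 \<le> c D \<and> c D \<le> beta n D) \<and>
     c {} = 0 \<and> c {1..n-1} = 0"

lemma feasible_realize:
  assumes c: "feasible n c"
  shows "\<exists>S. S \<subseteq> {w. w permutes {1..n}} \<and> int (card S) = sum c (Pow {1..n-1}) \<and>
    symmetric_set n S \<and> iota n \<notin> S \<and> delta n \<notin> S"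
proof -
  define B where "B D = {w. w permutes {1..n} \<and> Des n w = D}" for D
  have finB: "finite (B D)" for D
    unfolding B_def by (rule finite_subset[OF _ finite_permutations[of "{1..n}"]]) auto
  have "\<exists>T. T \<subseteq> B D \<and> card T = nat (c D)" if "D \<subseteq> {1..n-1}" for D
  proof -
    have "nat (c D) \<le> card (B D)" using c that by (auto simp: feasible_def beta_def B_def)
    then show ?thesis using obtain_subset_with_card_n by metis
  qed
  then obtain T where T: "\<And>D. D \<subseteq> {1..n-1} \<Longrightarrow> T D \<subseteq> B D \<and> card (T D) = nat (c D)"
    by metis
  define S where "S = (\<Union>D\<in>Pow {1..n-1}. T D)"
  have sumS: "sum f S = (\<Sum>D\<in>Pow {1..n-1}. sum f (T D))" for f :: "(nat \<Rightarrow> nat) \<Rightarrow> nat"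
    unfolding S_def
  proof (rule sum.UNION_disjoint)
    show "\<forall>D\<in>Pow {1..n-1}. finite (T D)" using T finB finite_subset by (metis PowD)
    show "\<forall>D\<in>Pow {1..n-1}. \<forall>D'\<in>Pow {1..n-1}. D \<noteq> D' \<longrightarrow> T D \<inter> T D' = {}"
    proof (intro ballI impI)
      fix D D' assume D: "D \<in> Pow {1..n-1}" "D' \<in> Pow {1..n-1}" "D \<noteq> D'"
      then have "T D \<subseteq> B D" "T D' \<subseteq> B D'" using T by auto
      then show "T D \<inter> T D' = {}" using D(3) by (auto simp: B_def)
    qed
  qed simp
  have "S \<subseteq> {w. w permutes {1..n}}"
  proof
    fix w assume "w \<in> S"
    then obtain D where "D \<subseteq> {1..n-1}" "w \<in> T D" by (auto simp: S_def)
    then show "w \<in> {w. w permutes {1..n}}" using T[of D] by (auto simp: B_def)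
  qed
  moreover have "int (card S) = sum c (Pow {1..n-1})"
  proof -
    have "card S = (\<Sum>D\<in>Pow {1..n-1}. card (T D))" using sumS[of "\<lambda>_. 1"] by simp
    also have "int \<dots> = (\<Sum>D\<in>Pow {1..n-1}. int (card (T D)))" by simp
    also have "\<dots> = sum c (Pow {1..n-1})"
      by (rule sum.cong[OF refl]) (use T c in \<open>auto simp: feasible_def\<close>)
    finally show ?thesis .
  qed
  moreover have "symmetric_set n S"
  proof -
    have Q: "int (Qcoeff n S a) = (if weight n a then sum c (Pow (cuts n a)) else 0)" for a
    proof -
      have "Qcoeff n S a = (\<Sum>D\<in>Pow {1..n-1}. \<Sum>w\<in>T D. Fcoeff n (Des n w) a)"
        unfolding Qcoeff_def by (rule sumS)
      also have "\<dots> = (\<Sum>D\<in>Pow {1..n-1}. nat (c D) * (if weight n a \<and> D \<subseteq> cuts n a then 1 else 0))"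
      proof (rule sum.cong[OF refl])
        fix D assume D: "D \<in> Pow {1..n-1}"
        have "(\<Sum>w\<in>T D. Fcoeff n (Des n w) a) = (\<Sum>w\<in>T D. Fcoeff n D a)"
          by (rule sum.cong[OF refl]) (use T[of D] D in \<open>auto simp: B_def\<close>)
        then show "(\<Sum>w\<in>T D. Fcoeff n (Des n w) a) =
            nat (c D) * (if weight n a \<and> D \<subseteq> cuts n a then 1 else 0)"
          using T[of D] D by (simp add: Fcoeff_eq)
      qed
      finally have e: "int (Qcoeff n S a) =
          (\<Sum>D\<in>Pow {1..n-1}. int (nat (c D) * (if weight n a \<and> D \<subseteq> cuts n a then 1 else 0)))"
        by simp
      have "Pow (cuts n a) \<subseteq> Pow {1..n-1}" by (auto simp: cuts_def)
      moreover have "c D = int (nat (c D))" if "D \<subseteq> {1..n-1}" for D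
        using c that by (simp add: feasible_def)
      ultimately have "sum c (Pow (cuts n a)) = (\<Sum>D\<in>Pow {1..n-1}. int (nat (c D) * (if D \<subseteq> cuts n a then 1 else 0)))"
        by (intro sum.mono_neutral_cong_left) (auto simp del: int_nat_eq)
      then show ?thesis using e by simp
    qed
    have "Qcoeff n S (a \<circ> \<sigma>) = Qcoeff n S a" if "\<sigma> permutes {1..}" for \<sigma> a
    proof -
      have "int (Qcoeff n S (a \<circ> \<sigma>)) = int (Qcoeff n S a)"
        unfolding Q weight_comp_iff[OF that] using c that
        by (simp add: feasible_def symmetric_coeffs_def)
      then show ?thesis by simp
    qed
    then show ?thesis by (simp add: symmetric_set_def)
  qed
  moreover have "w \<notin> S" if w: "c (Des n w) = 0" for w
  proof
    assume "w \<in> S"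
    then obtain D where D: "D \<subseteq> {1..n-1}" "w \<in> T D" by (auto simp: S_def)
    then have "D = Des n w" using T[of D] by (auto simp: B_def)
    moreover have "finite (T D)" using T[OF D(1)] finB finite_subset by metis
    ultimately show False using T[OF D(1)] D(2) w by (metis card_0_eq empty_iff nat_0)
  qed
  then have "iota n \<notin> S" "delta n \<notin> S"
    using c by (simp_all add: iota_def Des_id Des_delta feasible_def)
  ultimately show ?thesis by blast
qed

section \<open>Balanced coefficient functions\<close>

text \<open>The copies of \<open>F\<^bsub>n,{1}\<^esub>\<close> are the bottleneck when adding or removing the sum of all \<open>F\<^bsub>n,{i}\<^esub>\<close>.\<close>

definition balanced :: "nat \<Rightarrow> (nat set \<Rightarrow> int) \<Rightarrow> bool" where
  "balanced n c \<longleftrightarrow> c {1} \<le> int n - 3 \<and>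
     (\<forall>i\<in>{1..n-1}. c {1} \<le> c {i} \<and> beta n {1} - c {1} \<le> beta n {i} - c {i})"

text \<open>The Schur function of shape \<open>(n-k,1,...,1)\<close> with \<open>k\<close> ones, in
  which every descent set of size \<open>k\<close> occurs once.\<close>

definition hook :: "nat \<Rightarrow> nat set \<Rightarrow> int" where
  "hook k D = (if card D = k then 1 else 0)"

lemma two_times_choose_two: "2 * int (m choose 2) = int m * (int m - 1)"
proof (induction m)
  case (Suc m)
  have "Suc m choose 2 = m + (m choose 2)" by (simp add: numeral_2_eq_2)
  then show ?case using Suc by (simp add: algebra_simps)
qed simp

lemma symmetric_coeffs_hook: "n \<ge> 1 \<Longrightarrow> symmetric_coeffs n (hook k)"
  unfolding hook_def by (rule symmetric_coeffs_card)

lemma total_hook: "sum (hook k) (Pow {1..n-1}) = int ((n-1) choose k)"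
proof -
  have "sum (hook k) (Pow {1..n-1}) = (\<Sum>D\<in>{D \<in> Pow {1..n-1}. card D = k}. 1)"
    unfolding hook_def by (rule sum.inter_filter[symmetric]) simp
  also have "{D \<in> Pow {1..n-1}. card D = k} = {D. D \<subseteq> {1..n-1} \<and> card D = k}" by auto
  also have "(\<Sum>D\<in>{D. D \<subseteq> {1..n-1} \<and> card D = k}. 1::int) = int ((n-1) choose k)"
    using n_subsets[of "{1..n-1}" k] by simp
  finally show ?thesis .
qed

lemma total_near_top: "sum (near_top n) (Pow {1..n-1}) = int n"
proof -
  have e: "{i. i < n \<and> {1..n-1} - {i, Suc i} \<subseteq> {1..n-1}} = {..<n}" by auto
  show ?thesis unfolding sum_near_top[OF finite_atLeastAtMost] e by simp
qed

lemma near_top_nonneg: "0 \<le> near_top n D"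
  by (simp add: near_top_def)

text \<open>Different \<open>i\<close> leave different sets once \<open>n \<ge> 3\<close>; for
  \<open>n = 2\<close> both choices leave \<open>{}\<close>.\<close>

lemma near_top_le_1:
  assumes n: "n \<ge> 3"
  shows "near_top n D \<le> 1"
proof -
  have "i = i'" if "i < n" "i' < n" "i \<le> i'" "{1..n-1} - {i, Suc i} = {1..n-1} - {i', Suc i'}" for i i'
  proof (rule ccontr)
    assume "i \<noteq> i'"
    then have "i < i'" using that by simp
    have iff: "x \<in> {i, Suc i} \<longleftrightarrow> x \<in> {i', Suc i'}" if "1 \<le> x" "x \<le> n-1" for x
      using that \<open>{1..n-1} - {i, Suc i} = _\<close> by (auto simp: set_eq_iff)
    have "i' = Suc i" using iff[of "Suc i"] \<open>i < i'\<close> \<open>i' < n\<close> by auto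
    have "i \<le> n-1" using \<open>i < i'\<close> \<open>i' < n\<close> by linarith
    \<comment> \<open>Consecutive indices could agree only for \<open>i = 0\<close>, but then the
      element 2 tells them apart.\<close>
    then have "i = 0" using iff[of i] \<open>i' = Suc i\<close> by (cases "i = 0") auto
    moreover have "2 \<le> n-1" using n by linarith
    ultimately show False using iff[of 2] \<open>i' = Suc i\<close> by auto
  qed
  then have u: "\<And>i i'. i < n \<Longrightarrow> i' < n \<Longrightarrow> {1..n-1} - {i, Suc i} = {1..n-1} - {i', Suc i'} \<Longrightarrow> i = i'"
    by (metis nat_le_linear)
  have "card {i. i < n \<and> {1..n-1} - {i, Suc i} = D} \<le> Suc 0"
  proof (subst card_le_Suc0_iff_eq)
    show "\<forall>i\<in>{i. i < n \<and> {1..n-1} - {i, Suc i} = D}. \<forall>i'\<in>{i. i < n \<and> {1..n-1} - {i, Suc i} = D}. i = i'"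
      by (intro ballI u) (simp_all only: mem_Collect_eq)
  qed simp
  then show ?thesis by (simp add: near_top_def)
qed

lemma near_top_eq_1:
  assumes "n \<ge> 3" "i < n" "D = {1..n-1} - {i, Suc i}"
  shows "near_top n D = 1"
proof -
  let ?I = "{i. i < n \<and> {1..n-1} - {i, Suc i} = D}"
  have "i \<in> ?I" "finite ?I" using assms by simp_all
  then have "0 < card ?I" by (metis card_gt_0_iff empty_iff)
  then have "1 \<le> near_top n D" unfolding near_top_def by linarith
  then show ?thesis using near_top_le_1[OF assms(1), of D] by simp
qed

lemma near_top_eq_0:
  assumes n: "n \<ge> 3" and D: "card D \<noteq> n-2" "card D \<noteq> n-3"
  shows "near_top n D = 0"
proof -
  have "{1..n-1} - {i, Suc i} \<noteq> D" if "i < n" for i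
  proof
    assume e: "{1..n-1} - {i, Suc i} = D"
    have "card D = card {1..n-1} - card ({1..n-1} \<inter> {i, Suc i})"
      unfolding e[symmetric] by (rule card_Diff_subset_Int) simp
    moreover have "card ({1..n-1} \<inter> {i, Suc i}) \<in> {1, 2}"
    proof -
      consider "i = 0" | "i = n-1" "i \<noteq> 0" | "1 \<le> i" "i < n-1" using \<open>i < n\<close> by linarith
      then show ?thesis
      proof cases
        case 1
        then have "{1..n-1} \<inter> {i, Suc i} = {1}" using n by auto
        then show ?thesis by simp
      next
        case 2
        then have "{1..n-1} \<inter> {i, Suc i} = {i}" using n by auto
        then show ?thesis by simp
      next
        case 3
        then have "{1..n-1} \<inter> {i, Suc i} = {i, Suc i}" by auto
        then show ?thesis by simp
      qed
    qed
    ultimately show False using D by auto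
  qed
  then have "{i. i < n \<and> {1..n-1} - {i, Suc i} = D} = {}" by auto
  then show ?thesis by (simp add: near_top_def)
qed

lemma beta_card_1:
  assumes "n \<ge> 2" "D \<subseteq> {1..n-1}" "card D = 1"
  shows "int n - 1 \<le> beta n D"
proof -
  obtain i where "D = {i}" using assms(3) card_1_singletonE by metis
  then show ?thesis using assms beta_singleton_ge by simp
qed

lemma card_2_less:
  assumes "card (D::nat set) = 2"
  obtains i j where "D = {i, j}" "i < j"
  using assms by (metis card_2_iff insert_commute linorder_neqE_nat)

lemma beta_card_2:
  assumes "n \<ge> 3" "D \<subseteq> {1..n-1}" "card D = 2"
  shows "int ((n-1) choose 2) \<le> beta n D"
proof -
  obtain i j where "D = {i, j}" "i < j" using card_2_less[OF assms(3)] .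
  then show ?thesis using assms beta_pair_ge[of n i j] by simp
qed

lemma beta_card_co_1:
  assumes "n \<ge> 2" "D \<subseteq> {1..n-1}" "card D = n-2"
  shows "int n - 1 \<le> beta n D"
proof -
  have "card ({1..n-1} - D) = 1"
    using assms by (subst card_Diff_subset) (auto intro: finite_subset)
  then show ?thesis using beta_card_1[of n "{1..n-1} - D"] beta_Compl[OF assms(2)] assms(1) by auto
qed

lemma beta_card_co_2:
  assumes "n \<ge> 3" "D \<subseteq> {1..n-1}" "card D = n-3"
  shows "int ((n-1) choose 2) \<le> beta n D"
proof -
  have "card ({1..n-1} - D) = 2"
    using assms by (subst card_Diff_subset) (auto intro: finite_subset)
  then show ?thesis using beta_card_2[of n "{1..n-1} - D"] beta_Compl[OF assms(2)] assms(1) by auto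
qed

section \<open>Feasible functions from lifting and from direct combinations\<close>

text \<open>Since \<open>balanced n\<close> lets us add or remove copies of the Schur function of shape
  \<open>(n - 1, 1)\<close>, of size \<open>n - 1\<close>, every residue modulo \<open>n\<close> can be reached from multiples of \<open>n\<close>;
  two copies of shape \<open>(n - 2, 1, 1)\<close> have the same size as \<open>n - 2\<close> copies of it.\<close>

lemma lift_step:
  assumes n: "n \<ge> 5" and f: "feasible (n - 1) c" and b: "balanced (n - 1) c"
    and s: "0 \<le> c {1} + s" "c {1} + s \<le> int n - 3" and t: "0 \<le> t" "t \<le> 2"
  defines "d \<equiv> \<lambda>D. lift n c D + s * hook 1 D + t * hook 2 D"
  shows "feasible n d" "balanced n d"
    "sum d (Pow {1..n-1}) = int n * sum c (Pow {1..n-2}) + s * (int n - 1) + t * int ((n-1) choose 2)"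
proof -
  have n2: "n - 1 - 1 = n - 2" by simp
  \<comment> \<open>\<open>r\<close> is what \<open>c\<close> leaves over. As \<open>beta n\<close>
    is the lift of \<open>beta (n - 1)\<close>, upper bounds for \<open>d\<close> become lower
    bounds for the lift of \<open>r\<close>.\<close>
  define r where "r E = beta (n - 1) E - c E" for E
  have c0: "0 \<le> c E" and r0: "0 \<le> r E" if "E \<subseteq> {1..n-2}" for E
    using f that unfolding feasible_def r_def n2 by auto
  have ce: "c {} = 0" "c {1..n-2} = 0" using f unfolding feasible_def n2 by auto
  have cr: "beta n D = lift n c D + lift n r D" for D
  proof -
    have "beta n D = lift n (beta (n - 1)) D" using n by (intro beta_lift) simp
    then show ?thesis unfolding r_def lift_diff by simp
  qed
  have bal: "c {1} \<le> c {i}" "r {1} \<le> r {i}" if "i \<in> {1..n-2}" for i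
    using b that unfolding balanced_def n2 r_def by auto
  have u: "c {1} \<le> int n - 4" using b n unfolding balanced_def by (simp add: of_nat_diff)
  have re: "1 \<le> r {}" using ce beta_empty_ge[of "n - 1"] by (simp add: r_def)
  have r1: "int n - 2 - c {1} \<le> r {1}" using beta_singleton_ge[of "n - 1" 1] n by (simp add: r_def of_nat_diff)
  have min: "min i (n-2) \<in> {1..n-2}" if "i \<in> {1..n-1}" for i using that n by auto
  have lc: "c {1} \<le> lift n c {i}" and lr: "r {1} + r {} \<le> lift n r {i}" if "i \<in> {1..n-1}" for i
    using lift_singleton_ge[of n i c] lift_singleton_ge[of n i r] bal[OF min[OF that]] that n c0 r0 ce
    by fastforce+
  have first: "lift n c {1} = c {1}" "lift n r {1} = r {1} + r {}"
    using lift_first[of n] n ce by auto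
  have single: "d {i} = lift n c {i} + s" for i by (simp add: d_def hook_def)
  have bounds: "0 \<le> d D \<and> d D \<le> beta n D" if D: "D \<subseteq> {1..n-1}" for D
  proof -
    have l: "0 \<le> lift n c D" "0 \<le> lift n r D" using lift_nonneg c0 r0 by auto
    consider "card D = 1" | "card D = 2" | "card D \<noteq> 1" "card D \<noteq> 2" by blast
    then show ?thesis
    proof cases
      case 1
      then obtain i where i: "D = {i}" using card_1_singletonE by metis
      \<comment> \<open>Below, \<open>lift n c {i} \<ge> c {1} \<ge> - s\<close>; above,
        \<open>r {1} + r {} \<ge> n - 1 - c {1} > s\<close>.\<close>
      then show ?thesis using lc[of i] lr[of i] D s re r1 cr[of "{i}"] by (auto simp: single)
    next
      case 2
      then obtain i j where ij: "D = {i, j}" "i < j" using card_2_less by blast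
      then have "r {j-1} \<le> lift n r {i, j}" using D r0 by (intro lift_pair_ge) auto
      moreover have "r {1} \<le> r {j-1}" using ij D by (intro bal) auto
      \<comment> \<open>Since \<open>c {1} \<le> n - 4\<close>, at least two permutations of each
        pair class are left over, enough for \<open>t \<le> 2\<close>.\<close>
      ultimately have "2 \<le> lift n r D" using r1 u ij by simp
      then show ?thesis using l t cr[of D] 2 by (simp add: d_def hook_def)
    next
      case 3
      then show ?thesis using l cr[of D] by (simp add: d_def hook_def)
    qed
  qed
  have sym: "symmetric_coeffs n d"
    unfolding d_def using f n
    by (intro symmetric_coeffs_add symmetric_coeffs_scale symmetric_coeffs_hook symmetric_coeffs_lift)
      (auto simp: feasible_def)
  have "d {} = 0" using lift_empty[of c n] ce by (simp add: d_def hook_def)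
  moreover have "d {1..n-1} = 0"
  proof -
    have "n - 1 \<noteq> 1" "n - 1 \<noteq> 2" "lift n c {1..n-1} = 0"
      using n lift_full[of c n] ce by linarith+
    then show ?thesis by (simp add: d_def hook_def)
  qed
  ultimately show "feasible n d" using sym bounds by (simp add: feasible_def)
  show "balanced n d"
    unfolding balanced_def single
  proof (intro conjI ballI)
    show "lift n c {1} + s \<le> int n - 3" using first s by simp
    fix i assume i: "i \<in> {1..n-1}"
    show "lift n c {1} + s \<le> lift n c {i} + s" using lc[OF i] first by simp
    show "beta n {1} - (lift n c {1} + s) \<le> beta n {i} - (lift n c {i} + s)"
      using lr[OF i] first cr[of "{1}"] cr[of "{i}"] by simp
  qed
  have "sum d (Pow {1..n-1}) = sum (lift n c) (Pow {1..n-1}) + s * sum (hook 1) (Pow {1..n-1})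
      + t * sum (hook 2) (Pow {1..n-1})"
    unfolding d_def by (simp add: sum.distrib sum_distrib_left)
  then show "sum d (Pow {1..n-1}) = int n * sum c (Pow {1..n-2}) + s * (int n - 1) + t * int ((n-1) choose 2)"
    unfolding total_lift total_hook using n by (simp add: of_nat_diff)
qed

text \<open>Classes with 1 or \<open>n - 2\<close> descents have at least \<open>n - 1\<close>
  elements, those with 2 or \<open>n - 3\<close> at least \<open>(n-1) choose 2\<close>. The bound
  \<open>x \<le> n - 3\<close> comes from \<open>balanced\<close>.\<close>

lemma direct_step:
  assumes n: "n \<ge> 5" and nn: "0 \<le> x" "0 \<le> m" "0 \<le> y" "0 \<le> z"
    and ub: "x \<le> int n - 3" "y + z \<le> int n - 1" "m + z \<le> int ((n-1) choose 2)"
  defines "d \<equiv> \<lambda>D. x * hook 1 D + m * hook 2 D + y * hook (n-2) D + z * near_top n D"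
  shows "feasible n d" "balanced n d"
    "sum d (Pow {1..n-1}) = x * (int n - 1) + m * int ((n-1) choose 2) + y * (int n - 1) + z * int n"
proof -
  \<comment> \<open>This form lets simplification separate the sizes 1, 2, \<open>n - 3\<close> and
    \<open>n - 2\<close>, of which only 2 and \<open>n - 3\<close> can coincide, for
    \<open>n = 5\<close>.\<close>
  obtain l where l: "n = Suc (Suc (Suc (Suc (Suc l))))"
    using n le_Suc_ex[of 5 n] by (auto simp: eval_nat_numeral)
  have z1: "0 \<le> z * near_top n D" "z * near_top n D \<le> z" for D
    using nn near_top_nonneg near_top_le_1[of n D] n
    by (auto intro: mult_nonneg_nonneg mult_left_le)
  have nt: "z * near_top n D = 0" if "card D \<noteq> n-2" "card D \<noteq> n-3" for D
    using near_top_eq_0[OF _ that] n by simp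
  have single: "d {i} = x" for i using nt[of "{i}"] n by (simp add: l d_def hook_def)
  have bounds: "0 \<le> d D \<and> d D \<le> beta n D" if D: "D \<subseteq> {1..n-1}" for D
  proof -
    consider "card D = 1" | "card D = n-2" | "card D = 2 \<or> card D = n-3"
      | "card D \<notin> {1, 2, n-2, n-3}" by blast
    then show ?thesis
    proof cases
      case 1
      then have "d D = x" using nt[of D] by (simp add: l d_def hook_def)
      then show ?thesis using 1 n nn ub beta_card_1[OF _ D] by simp
    next
      case 2
      then have "d D = y + z * near_top n D" by (simp add: l d_def hook_def)
      moreover have "int n - 1 \<le> beta n D" using 2 n by (intro beta_card_co_1[OF _ D]) simp_all
      ultimately show ?thesis using z1[of D] nn ub by linarith
    next
      case 3
      then have "int ((n-1) choose 2) \<le> beta n D"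
        using beta_card_2[OF _ D] beta_card_co_2[OF _ D] n by auto
      moreover have "d D = m * hook 2 D + z * near_top n D"
        using 3 n by (auto simp: l d_def hook_def)
      moreover have "0 \<le> m * hook 2 D" "m * hook 2 D \<le> m" using nn by (auto simp: hook_def)
      ultimately show ?thesis using z1[of D] ub by linarith
    next
      case 4
      then have "d D = 0" using nt[of D] by (simp add: l d_def hook_def)
      then show ?thesis using beta_nonneg by simp
    qed
  qed
  have sym: "symmetric_coeffs n d"
    unfolding d_def using n
    by (intro symmetric_coeffs_add symmetric_coeffs_scale symmetric_coeffs_hook symmetric_coeffs_near_top)
      auto
  have "d {} = 0" using nt[of "{}"] n by (simp add: l d_def hook_def)
  moreover have "d {1..n-1} = 0"
  proof -
    have "n - 1 \<noteq> 1" "n - 1 \<noteq> 2" "n - 1 \<noteq> n - 2" "n - 1 \<noteq> n - 3" using n by linarith+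
    then show ?thesis using nt[of "{1..n-1}"] by (simp add: l d_def hook_def)
  qed
  ultimately show "feasible n d" using sym bounds by (simp add: feasible_def)
  show "balanced n d" unfolding balanced_def single using ub n beta_singleton_min[of n] by auto
  have c1: "(n-1) choose (n-2) = n-1"
    using n binomial_symmetric[of "n-2" "n-1"] by simp
  have "sum d (Pow {1..n-1}) = x * sum (hook 1) (Pow {1..n-1}) + m * sum (hook 2) (Pow {1..n-1})
      + y * sum (hook (n-2)) (Pow {1..n-1}) + z * sum (near_top n) (Pow {1..n-1})"
    unfolding d_def by (simp add: sum.distrib sum_distrib_left)
  then show "sum d (Pow {1..n-1}) = x * (int n - 1) + m * int ((n-1) choose 2) + y * (int n - 1) + z * int n"
    unfolding total_near_top total_hook c1 using n by (simp add: of_nat_diff)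
qed

text \<open>This size is the Frobenius number of \<open>n - 1\<close> and \<open>n\<close>, reached
  here as \<open>(n - 1) + (n - 1)(n - 2) - n\<close>. The subtraction is possible because
  \<open>near_top n\<close> is at most 1 and lives on the descent numbers of the two hooks.\<close>

lemma direct_exceptional:
  assumes n: "n \<ge> 5"
  defines "d \<equiv> \<lambda>D. hook (n-2) D + 2 * hook (n-3) D - near_top n D"
  shows "feasible n d" "balanced n d" "sum d (Pow {1..n-1}) = (int n - 1) * (int n - 2) - 1"
proof -
  obtain l where l: "n = Suc (Suc (Suc (Suc (Suc l))))"
    using n le_Suc_ex[of 5 n] by (auto simp: eval_nat_numeral)
  have n1: "0 \<le> near_top n D" "near_top n D \<le> 1" for D
    using near_top_nonneg near_top_le_1[of n D] n by auto
  have nt: "near_top n D = 0" if "card D \<noteq> n-2" "card D \<noteq> n-3" for D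
    using near_top_eq_0[OF _ that] n by simp
  have single: "d {i} = 0" for i using nt[of "{i}"] n by (simp add: l d_def hook_def)
  have two: "2 * int ((n-1) choose 2) = (int n - 1) * (int n - 2)"
  proof -
    have "int (n - 1) = int n - 1" using n by simp
    then show ?thesis using two_times_choose_two[of "n - 1"] by simp
  qed
  have "4 * 3 \<le> (int n - 1) * (int n - 2)" using n by (intro mult_mono) auto
  then have c2: "2 \<le> int ((n-1) choose 2)" using two by linarith
  have bounds: "0 \<le> d D \<and> d D \<le> beta n D" if D: "D \<subseteq> {1..n-1}" for D
  proof -
    consider "card D = n-2" | "card D = n-3" | "card D \<notin> {n-2, n-3}" by blast
    then show ?thesis
    proof cases
      case 1
      then have "d D = 1 - near_top n D" by (simp add: l d_def hook_def)
      moreover have "int n - 1 \<le> beta n D" using 1 n by (intro beta_card_co_1[OF _ D]) simp_all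
      ultimately show ?thesis using n1[of D] n by linarith
    next
      case 2
      then have "d D = 2 - near_top n D" by (simp add: l d_def hook_def)
      moreover have "int ((n-1) choose 2) \<le> beta n D"
        using 2 n by (intro beta_card_co_2[OF _ D]) simp_all
      ultimately show ?thesis using n1[of D] c2 by linarith
    next
      case 3
      then have "d D = 0" using nt[of D] by (simp add: l d_def hook_def)
      then show ?thesis using beta_nonneg by simp
    qed
  qed
  have sym: "symmetric_coeffs n d"
    unfolding d_def using n
    by (intro symmetric_coeffs_add symmetric_coeffs_diff symmetric_coeffs_scale symmetric_coeffs_hook
        symmetric_coeffs_near_top) auto
  have "d {} = 0" using nt[of "{}"] n by (simp add: l d_def hook_def)
  moreover have "d {1..n-1} = 0"
  proof -
    have "n - 1 \<noteq> 1" "n - 1 \<noteq> 2" "n - 1 \<noteq> n - 2" "n - 1 \<noteq> n - 3" using n by linarith+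
    then show ?thesis using nt[of "{1..n-1}"] by (simp add: l d_def hook_def)
  qed
  ultimately show "feasible n d" using sym bounds by (simp add: feasible_def)
  show "balanced n d" unfolding balanced_def single using n beta_singleton_min[of n] by auto
  have c: "(n-1) choose (n-2) = n-1" "(n-1) choose (n-3) = (n-1) choose 2"
    using n binomial_symmetric[of "n-2" "n-1"] binomial_symmetric[of "n-3" "n-1"]
    by (simp_all add: numeral_2_eq_2)
  have "sum d (Pow {1..n-1}) = sum (hook (n-2)) (Pow {1..n-1}) + 2 * sum (hook (n-3)) (Pow {1..n-1})
      - sum (near_top n) (Pow {1..n-1})"
    unfolding d_def by (simp add: sum.distrib sum_distrib_left sum_subtractf)
  then show "sum d (Pow {1..n-1}) = (int n - 1) * (int n - 2) - 1"
    unfolding total_near_top total_hook c two[symmetric] using n by (simp add: of_nat_diff)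
qed

text \<open>The bracket is the Schur function of shape \<open>(2,2)\<close>, of size 2, living on
  \<open>{2}\<close> and \<open>{1, 3}\<close>; \<open>hook 2\<close> has size 3. The gap
  \<open>beta 4 {1} + 2 \<le> beta 4 {2}\<close> makes \<open>b \<le> 2\<close> compatible with
  \<open>balanced\<close>.\<close>

lemma direct_four:
  assumes y: "0 \<le> y" "y \<le> 3" and b: "0 \<le> b" "b \<le> 2" and yb: "y + b \<le> 4"
  defines "d \<equiv> \<lambda>D. y * hook 2 D + b * (hook 1 D + hook 2 D - near_top 4 D)"
  shows "feasible 4 d" "balanced 4 d" "sum d (Pow {1..4-1}) = 3 * y + 2 * b"
proof -
  have nt: "near_top 4 {1} = 1" "near_top 4 {3} = 1" "near_top 4 {1, 2} = 1" "near_top 4 {2, 3} = 1"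
    by (rule near_top_eq_1[of 4 2] near_top_eq_1[of 4 0] near_top_eq_1[of 4 3] near_top_eq_1[of 4 1]; auto; fail)+
  have nt01: "0 \<le> near_top 4 D" "near_top 4 D \<le> 1" for D
    using near_top_nonneg near_top_le_1[of 4 D] by auto
  have nt0: "near_top 4 D = 0" if "card D \<noteq> 1" "card D \<noteq> 2" for D
    using near_top_eq_0[of 4 D] that by simp
  have d1: "d {1} = 0" "d {3} = 0" "d {1, 2} = y" "d {2, 3} = y"
    using nt by (simp_all add: d_def hook_def)
  have bm: "0 \<le> b * (1 - near_top 4 D)" "b * (1 - near_top 4 D) \<le> b" for D
    using b nt01[of D] by (auto intro: mult_nonneg_nonneg mult_left_le)
  have d2: "0 \<le> d {2}" "d {2} \<le> b" using bm[of "{2}"] by (simp_all add: d_def hook_def)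
  have d13: "0 \<le> d {1, 3}" "d {1, 3} \<le> y + b" using bm[of "{1, 3}"] y by (simp_all add: d_def hook_def)
  have b3: "int ((3::nat) choose 2) = 3" by (simp add: numeral_2_eq_2 numeral_3_eq_3)
  have diff: "beta 4 {1} + 2 \<le> beta 4 {2}"
  proof -
    have "beta 3 {2} + beta 3 {2-1} + beta 3 {} \<le> lift 4 (beta 3) {2}"
      by (intro lift_interior_singleton_ge beta_nonneg) auto
    moreover have "lift 4 (beta 3) {1} = beta 3 {1} + beta 3 {}" by (intro lift_first) simp
    moreover have "2 \<le> beta 3 {2}" using beta_singleton_ge[of 3 2] by simp
    ultimately show ?thesis using beta_lift[of 4] by simp
  qed
  have b4: "3 \<le> beta 4 {1}" "3 \<le> beta 4 {3}" "3 \<le> beta 4 {1, 2}" "3 \<le> beta 4 {2, 3}"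
    using beta_singleton_ge[of 4] beta_pair_ge[of 4] b3 by auto
  have "{1..4-1} - {2} = {1, 3::nat}" by auto
  then have b13: "5 \<le> beta 4 {1, 3}" using beta_Compl[of "{2}" 4] diff b4 by simp
  have bounds: "0 \<le> d D \<and> d D \<le> beta 4 D" if D: "D \<subseteq> {1..4-1}" for D
  proof -
    have "{1..4-1} = {1, 2, 3::nat}" by auto
    then have "D \<in> Pow {1, 2, 3}" using D by simp
    then consider "card D = 0 \<or> card D = 3" | "D = {1}" | "D = {2}" | "D = {3}"
      | "D = {1, 2}" | "D = {1, 3}" | "D = {2, 3}"
      by (auto simp: Pow_insert)
    then show ?thesis
    proof cases
      case 1
      then show ?thesis using nt0[of D] beta_nonneg by (auto simp: d_def hook_def)
    qed (use d1 d2 d13 b4 b13 diff y b yb in auto)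
  qed
  have sym: "symmetric_coeffs 4 d"
    unfolding d_def
    by (intro symmetric_coeffs_add symmetric_coeffs_diff symmetric_coeffs_scale symmetric_coeffs_hook
        symmetric_coeffs_near_top) auto
  have "d {} = 0" using nt0[of "{}"] by (simp add: d_def hook_def)
  moreover have "d {1..4-1} = 0" using nt0[of "{1..4-1}"] by (simp add: d_def hook_def)
  ultimately show "feasible 4 d" using sym bounds by (simp add: feasible_def)
  show "balanced 4 d"
    unfolding balanced_def
  proof (intro conjI ballI)
    show "d {1} \<le> int 4 - 3" using d1 by simp
    fix i :: nat assume "i \<in> {1..4-1}"
    then have i: "i = 1 \<or> i = 2 \<or> i = 3" by auto
    then show "d {1} \<le> d {i}" using d1 d2 by auto
    show "beta 4 {1} - d {1} \<le> beta 4 {i} - d {i}"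
      using i d1 d2 diff b beta_singleton_min[of 4 3] by auto
  qed
  have "sum d (Pow {1..4-1}) = y * sum (hook 2) (Pow {1..4-1}) + b * (sum (hook 1) (Pow {1..4-1})
      + sum (hook 2) (Pow {1..4-1}) - sum (near_top 4) (Pow {1..4-1}))"
    unfolding d_def by (simp add: sum.distrib sum_distrib_left[symmetric] sum_subtractf)
  then show "sum d (Pow {1..4-1}) = 3 * y + 2 * b"
    unfolding total_near_top total_hook using b3 by simp
qed

section \<open>Arithmetic of the attainable sizes\<close>

text \<open>Here \<open>N = n - 1\<close> and \<open>h\<close> is the size of \<open>hook 2\<close>.
  Copies of size \<open>h\<close> shrink \<open>p\<close> to a remainder \<open>k N + z\<close>,
  which is split into \<open>z\<close> parts \<open>N + 1\<close> and \<open>k - z\<close> parts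
  \<open>N\<close>.\<close>

lemma small_sum_representation:
  fixes N h p :: int
  assumes N: "N \<ge> 4" and h: "2 * h = N * (N - 1)" and lo: "N * (N - 2) \<le> p"
    and ne: "p \<noteq> N * (N - 1) - 1" and hi: "p < (N + 1) * ((N - 1) * (N - 3)) + N * N"
  shows "\<exists>x m y z. 0 \<le> x \<and> 0 \<le> m \<and> 0 \<le> y \<and> 0 \<le> z \<and> x \<le> N - 2 \<and> y + z \<le> N \<and> m + z \<le> h \<and>
    p = x * N + m * h + y * N + z * (N + 1)"
proof -
  have "4 * 3 \<le> N * (N - 1)" using N by (intro mult_mono) auto
  then have hpos: "h > 0" using h by linarith
  have hN: "2 * (h - N + 1) = (N - 1) * (N - 2)" using h by (simp add: algebra_simps)
  have "3 * 2 \<le> (N - 1) * (N - 2)" using N by (intro mult_mono) auto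
  then have "3 * 2 \<le> 2 * (h - N + 1)" unfolding hN .
  then have hN0: "0 \<le> h - N + 1" by simp
  \<comment> \<open>The bound on \<open>m\<close> leaves room for \<open>z \<le> N - 1\<close>. The
    window for the remainder forces \<open>k \<le> 2 N - 2\<close> and, unless \<open>m = 0\<close>,
    \<open>k \<ge> N - 1\<close>.\<close>
  obtain m where m: "0 \<le> m" "m \<le> h - N + 1" "p - m * h < N * (2 * N - 1)"
    "m = 0 \<or> N * (N - 1) \<le> p - m * h"
  proof (cases "p < N * (2 * N - 1)")
    case True
    then show ?thesis using that[of 0] hN0 by simp
  next
    case False
    define e where "e = p - N * (2 * N - 1)"
    define m where "m = e div h + 1"
    have e0: "0 \<le> e" using False by (simp add: e_def)
    have div: "h * (e div h) \<le> e" "e < h * (e div h) + h"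
    proof -
      have "h * (e div h) + e mod h = e" "0 \<le> e mod h" "e mod h < h" using hpos by simp_all
      then show "h * (e div h) \<le> e" "e < h * (e div h) + h" by linarith+
    qed
    have q: "p - m * h = N * (2 * N - 1) + (e - h * (e div h)) - h"
      by (simp add: e_def m_def algebra_simps)
    have "m \<le> h - N + 1"
    proof (rule ccontr)
      assume "\<not> m \<le> h - N + 1"
      then have "h * (h - N + 1) \<le> h * (e div h)" using hpos by (intro mult_left_mono) (auto simp: m_def)
      then have "(2 * h) * (2 * (h - N + 1)) \<le> 4 * e" using div by (simp add: algebra_simps)
      \<comment> \<open>A larger \<open>m\<close> would give \<open>Y \<le> 4 e < 4 X\<close>, but
        \<open>Y - 4 X\<close> factors into two positive terms for \<open>N \<ge> 4\<close>.\<close>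
      define X where "X = (N + 1) * ((N - 1) * (N - 3)) + N * N - N * (2 * N - 1)"
      define Y where "Y = N * (N - 1) * ((N - 1) * (N - 2))"
      have 1: "Y \<le> 4 * e" using \<open>(2 * h) * (2 * (h - N + 1)) \<le> 4 * e\<close> unfolding h hN Y_def .
      have 2: "e < X" using hi by (simp add: e_def X_def)
      have "0 < N * (N - 3) * (N - 4) + 2 * N + 12"
        using N by (intro add_nonneg_pos add_nonneg_nonneg mult_nonneg_nonneg) auto
      then have "0 \<le> (N - 1) * (N * (N - 3) * (N - 4) + 2 * N + 12)"
        using N by (intro mult_nonneg_nonneg) auto
      also have "\<dots> = Y - 4 * X" by (simp add: X_def Y_def algebra_simps)
      finally show False using 1 2 by linarith
    qed
    moreover have "0 \<le> m" using e0 hpos by (simp add: m_def pos_imp_zdiv_nonneg_iff)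
    moreover have "p - m * h < N * (2 * N - 1)" using q div by linarith
    moreover have "N * (N - 1) \<le> p - m * h"
    proof -
      have "N * (2 * N - 1) = N * (N - 1) + 2 * h + N" unfolding h by (simp add: algebra_simps)
      then have "p - m * h = N * (N - 1) + (h + N + (e - h * (e div h)))" using q by simp
      moreover have "0 \<le> h + N + (e - h * (e div h))" using div hpos N by simp
      ultimately show ?thesis by simp
    qed
    ultimately show ?thesis using that[of m] by blast
  qed
  define q where "q = p - m * h"
  define k where "k = q div N"
  define z where "z = q mod N"
  have qk: "q = k * N + z" by (simp add: k_def z_def)
  have z: "0 \<le> z" "z < N" using N by (simp_all add: z_def)
  have "k < 2 * N - 1"
  proof (rule ccontr)
    assume "\<not> k < 2 * N - 1"
    then have "(2 * N - 1) * N \<le> k * N" using N by (intro mult_right_mono) auto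
    then show False using m(3) qk z by (simp add: q_def algebra_simps)
  qed
  \<comment> \<open>The only obstruction is \<open>k = N - 2\<close>, \<open>z = N - 1\<close>,
    which is the excluded value of \<open>p\<close>.\<close>
  have zk: "z \<le> k"
  proof (cases "N * (N - 1) \<le> q")
    case True
    have "N - 1 \<le> k"
    proof (rule ccontr)
      assume "\<not> N - 1 \<le> k"
      then have "k * N \<le> (N - 2) * N" using N by (intro mult_right_mono) auto
      then show False using True qk z by (simp add: algebra_simps)
    qed
    then show ?thesis using z by simp
  next
    case False
    then have "q = p" using m(4) by (auto simp: q_def)
    have "N - 2 \<le> k"
    proof (rule ccontr)
      assume "\<not> N - 2 \<le> k"
      then have "k * N \<le> (N - 3) * N" using N by (intro mult_right_mono) auto
      then show False using lo \<open>q = p\<close> qk z by (simp add: algebra_simps)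
    qed
    show ?thesis
    proof (cases "N - 1 \<le> k")
      case True
      then show ?thesis using z by simp
    next
      case False
      then have "k = N - 2" using \<open>N - 2 \<le> k\<close> by simp
      define W where "W = N * (N - 1)"
      have "q = W - N + z" using qk \<open>k = N - 2\<close> by (simp add: W_def algebra_simps)
      moreover have "q < W" "q \<noteq> W - 1"
        using \<open>\<not> N * (N - 1) \<le> q\<close> ne \<open>q = p\<close> by (simp_all add: W_def)
      ultimately have "z < N - 1" by linarith
      then show ?thesis using \<open>k = N - 2\<close> by simp
    qed
  qed
  \<comment> \<open>The \<open>N\<close> places shared by \<open>y\<close> and \<open>z\<close> are
    filled first; the excess, at most \<open>N - 2\<close>, goes to \<open>x\<close>.\<close>
  define x where "x = max 0 (k - N)"
  define y where "y = min k N - z"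
  have "x + y + z = k" by (simp add: x_def y_def)
  then have "p = m * h + ((x + y + z) * N + z)" using qk by (simp add: q_def)
  then have "p = x * N + m * h + y * N + z * (N + 1)" by (simp add: algebra_simps)
  moreover have "0 \<le> x" "0 \<le> y" "x \<le> N - 2" "y + z \<le> N"
    using zk z \<open>k < 2 * N - 1\<close> N by (auto simp: x_def y_def)
  moreover have "m + z \<le> h" using m(2) z by simp
  ultimately show ?thesis using m(1) z by blast
qed

section \<open>Existence for all sizes in the range\<close>

lemma exists_direct:
  assumes n: "n \<ge> 5" and lo: "(int n - 1) * (int n - 3) \<le> p"
    and hi: "p < int n * ((int n - 2) * (int n - 4)) + (int n - 1) * (int n - 1)"
  shows "\<exists>c. feasible n c \<and> balanced n c \<and> sum c (Pow {1..n-1}) = p"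
proof (cases "p = (int n - 1) * (int n - 2) - 1")
  case True
  then show ?thesis using direct_exceptional[OF n] by blast
next
  case False
  define N where "N = int n - 1"
  define h where "h = int ((n-1) choose 2)"
  have "2 * h = N * (N - 1)"
    using two_times_choose_two[of "n - 1"] n by (simp add: h_def N_def of_nat_diff)
  then obtain x m y z where r: "0 \<le> x" "0 \<le> m" "0 \<le> y" "0 \<le> z" "x \<le> N - 2" "y + z \<le> N" "m + z \<le> h"
    "p = x * N + m * h + y * N + z * (N + 1)"
    using small_sum_representation[of N h p] n lo hi False by (auto simp: N_def)
  then have "x \<le> int n - 3" "y + z \<le> int n - 1" by (simp_all add: N_def)
  from direct_step[OF n r(1-4) this r(7)[unfolded h_def]] r(8)
  show ?thesis unfolding N_def h_def by (intro exI[of _ "\<lambda>D. x * hook 1 D + m * hook 2 D + y * hook (n-2) D + z * near_top n D"]) simp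
qed

lemma exists_four:
  assumes "3 \<le> p" "p \<le> 11"
  shows "\<exists>c. feasible 4 c \<and> balanced 4 c \<and> sum c (Pow {1..4-1}) = p"
proof -
  \<comment> \<open>\<open>b\<close> is chosen with \<open>p\<close> congruent to \<open>2 b\<close>
    modulo 3.\<close>
  define b where "b = (if p \<in> {3, 6, 9} then 0 else if p \<in> {5, 8, 11} then 1 else (2::int))"
  define y where "y = (p - 2 * b) div 3"
  have "p \<in> {3, 4, 5, 6, 7, 8, 9, 10, 11}" using assms by auto
  then have "0 \<le> y \<and> y \<le> 3 \<and> 0 \<le> b \<and> b \<le> 2 \<and> y + b \<le> 4 \<and> 3 * y + 2 * b = p"
    by (auto simp: y_def b_def)
  then show ?thesis using direct_four[of y b] by blast
qed

lemma exists_balanced: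
  "n \<ge> 4 \<Longrightarrow> (int n - 1) * (int n - 3) \<le> p \<Longrightarrow> 2 * p + 2 \<le> fact n \<Longrightarrow>
    \<exists>c. feasible n c \<and> balanced n c \<and> sum c (Pow {1..n-1}) = p"
proof (induction n arbitrary: p rule: nat_induct_at_least)
  case base
  have "fact 4 = (24::int)" by (simp add: fact_numeral)
  then show ?case using base exists_four[of p] by simp
next
  case (Suc k)
  define n where "n = Suc k"
  have n: "n \<ge> 5" and nk: "n - 1 = k" "int k = int n - 1" using Suc.hyps by (simp_all add: n_def)
  have n2: "k - 1 = n - 2" by (simp add: n_def)
  show ?case
  \<comment> \<open>From this threshold on, the size \<open>p'\<close> to be lifted meets the lower
    bound for \<open>n - 1\<close>, even after up to \<open>n - 1\<close> copies of
    \<open>hook 1\<close> are split off.\<close>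
  proof (cases "p < int n * ((int n - 2) * (int n - 4)) + (int n - 1) * (int n - 1)")
    case True
    then show ?thesis using exists_direct[of n p] n Suc.prems by (simp only: n_def[symmetric])
  next
    case False
    \<comment> \<open>As \<open>n - 1\<close> is -1 modulo \<open>n\<close>, taking away
      \<open>a\<close> copies of \<open>hook 1\<close> leaves a multiple of
      \<open>n\<close>.\<close>
    define a where "a = (- p) mod int n"
    have a: "0 \<le> a" "a \<le> int n - 1" using n by (simp_all add: a_def)
    have "int n dvd p + a"
      unfolding a_def by (metis add.commute dvd_minus_iff minus_add_distrib minus_minus mod_eq_dvd_iff mod_mod_trivial diff_minus_eq_add)
    then have "int n dvd p + a - int n * a" by simp
    then obtain p' where p': "p + a - int n * a = int n * p'" by (elim dvdE)
    have pp: "p = int n * p' + a * (int n - 1)" using p' by (simp add: algebra_simps)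
    have "a * (int n - 1) \<le> (int n - 1) * (int n - 1)" using a n by (intro mult_right_mono) auto
    then have "int n * ((int n - 2) * (int n - 4)) \<le> int n * p'" using False pp by linarith
    then have lo: "(int k - 1) * (int k - 3) \<le> p'" using n nk by simp
    have "fact n = int n * fact k" by (simp add: n_def)
    moreover have "0 \<le> a * (int n - 1)" using a n by simp
    ultimately have "int n * (2 * p') < int n * fact k"
      using Suc.prems(2) pp unfolding n_def[symmetric] by (simp add: algebra_simps)
    then have "2 * p' < fact k" using n by (simp add: mult_less_cancel_left)
    \<comment> \<open>Parity sharpens \<open>2 p' < (n - 1)!\<close> by one more unit, which
      reproduces the upper bound.\<close>
    moreover have "even (fact k :: int)"
    proof -
      have "even (fact k :: nat)" using Suc.hyps by (intro dvd_fact) auto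
      then have "even (int (fact k))" by (simp only: even_of_nat)
      then show ?thesis by simp
    qed
    ultimately have hi: "2 * p' + 2 \<le> fact k" by presburger
    obtain c where c: "feasible k c" "balanced k c" "sum c (Pow {1..k-1}) = p'"
      using Suc.IH[OF lo hi] by blast
    note step = lift_step[OF n c(1,2)[folded nk(1)]]
    have c1: "0 \<le> c {1}" "c {1} \<le> int n - 4"
      using c Suc.hyps nk by (auto simp: feasible_def balanced_def)
    have h: "2 * int ((n-1) choose 2) = (int n - 1) * (int n - 2)"
      using two_times_choose_two[of "n - 1"] nk by simp
    show ?thesis
    proof (cases "c {1} + a \<le> int n - 3")
      case True
      then show ?thesis using step[of a 0] a c1 c(3) pp unfolding n_def[symmetric] n2
        by (intro exI[of _ "\<lambda>D. lift n c D + a * hook 1 D + 0 * hook 2 D"]) simp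
    next
      case False
      \<comment> \<open>Too many copies of \<open>hook 1\<close>: \<open>n - 2\<close> of them are
        traded for two copies of \<open>hook 2\<close>. Now \<open>s\<close> may be negative, but
        \<open>0 \<le> c {1} + s \<le> n - 3\<close>.\<close>
      define s where "s = a - (int n - 2)"
      have "p = int n * p' + s * (int n - 1) + 2 * int ((n-1) choose 2)"
        unfolding h s_def pp by (simp add: algebra_simps)
      then show ?thesis using step[of s 2] False a c1 c(3) unfolding n_def[symmetric] n2
        by (intro exI[of _ "\<lambda>D. lift n c D + s * hook 1 D + 2 * hook 2 D"]) (simp add: s_def)
    qed
  qed
qed

theorem theorem1p1:
  fixes n p :: nat
  assumes "n \<ge> 4"
    and "(n - 1) * (n - 3) \<le> p"
    and "2 * p \<le> fact n - 2"
  shows "\<exists>S. S \<subseteq> {w. w permutes {1..n}} \<and> card S = p \<and> symmetric_set n S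
             \<and> iota n \<notin> S \<and> delta n \<notin> S"
proof -
  have "int ((n - 1) * (n - 3)) \<le> int p" using assms(2) by (simp only: of_nat_le_iff)
  then have lo: "(int n - 1) * (int n - 3) \<le> int p" using assms(1) by (simp add: of_nat_diff)
  \<comment> \<open>This makes the truncated subtraction in \<open>fact n - 2\<close> a genuine
    one.\<close>
  have "n \<le> fact n" by (rule fact_ge_self)
  then have "2 * p + 2 \<le> fact n" using assms by linarith
  then have "int (2 * p + 2) \<le> int (fact n)" by (simp only: of_nat_le_iff)
  then have "2 * int p + 2 \<le> fact n" by simp
  then obtain c where c: "feasible n c" "sum c (Pow {1..n-1}) = int p"
    using exists_balanced[OF assms(1) lo] by blast
  show ?thesis using feasible_realize[OF c(1)] unfolding c(2) of_nat_eq_iff by blast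
qed

end
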